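(* Let $p,q>1$ with $1/p+1/q=1$, let $K_j\subset\mathbb{C}$ be compact and non-pluripolar (i.e. non-polar) for $j=1,\dots,n$, let $K=K_1\times\dots\times K_n\subset\mathbb{C}^n$, and let $S=\{x\in\mathbb{R}^n_+\,;\,\|x\|_p\le 1\}$. Then, for all $z=(z_1,\dots,z_n)\in\mathbb{C}^n$, $$V^S_K(z)^q=V_{K_1}(z_1)^q+\dots+V_{K_n}(z_n)^q.$$
   Context: $\mathbb{R}_+=[0,\infty)$, $\mathbb{C}^{*n}=(\mathbb{C}\setminus\{0\})^n$; $\|\cdot\|_p$ is the $\ell^p$-norm on $\mathbb{R}^n$. For compact convex $S\subset\mathbb{R}^n$, $\varphi_S(\xi)=\sup_{x\in S}\langle x,\xi\rangle$ is its supporting function. For $S\subset\mathbb{R}^n_+$ compact convex containing $0$, the logarithmic supporting function is $H_S(z)=\varphi_S(\log|z_1|,\dots,\log|z_n|)$ for $z\in\mathbb{C}^{*n}$, extended to $\mathbb{C}^n$ by $H_S(z)=\varlimsup_{\mathbb{C}^{*n}\ni w\to z}H_S(w)$. The Lelong class $\mathcal{L}^S(\mathbb{C}^n)$ consists of all plurisubharmonic $u$ on $\mathbb{C}^n$ such that $u\le H_S+c_u$ for some constant $c_u$. For compact $K\subset\mathbb{C}^n$, $V^S_K(z)=\sup\{u(z)\,;\,u\in\mathcal{L}^S(\mathbb{C}^n),\ u|_K\le 0\}$. When the superscript is omitted, $S$ is the standard simplex; thus for compact $L\subset\mathbb{C}$, $V_L=V_L^{[0,1]}$ is the supremum of all subharmonic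 $u$ on $\mathbb{C}$ with $u(\zeta)\le\log^+|\zeta|+c_u$ for some constant $c_u$ and $u|_L\le 0$. *)

theory Defs
  imports "HOL-Analysis.Analysis"
begin

text \<open>Subharmonic and plurisubharmonic functions take values in \<open>[-\<infinity>, \<infinity>)\<close> and are
  represented as \<open>ereal\<close>-valued functions. The constant \<open>-\<infinity>\<close> is admitted; conventions
  differ on this, but it has no influence on the suprema below, and polarity excludes it
  explicitly.\<close>

definition usc :: "('a::topological_space \<Rightarrow> ereal) \<Rightarrow> bool" where
  "usc u \<longleftrightarrow> (\<forall>c. open {x. u x < c})"

text \<open>The integral of \<open>f\<close> as \<open>\<integral>f\<^sup>+ - \<integral>f\<^sup>-\<close>; note that \<open>e2ennreal\<close> truncates negative
  values to \<open>0\<close>. It is only used where \<open>\<integral>f\<^sup>+ < \<infinity>\<close>, since \<open>\<infinity> - \<infinity> = \<infinity>\<close> in \<open>ereal\<close>.\<close>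

definition ereal_integral :: "'a measure \<Rightarrow> ('a \<Rightarrow> ereal) \<Rightarrow> ereal" where
  "ereal_integral M f =
     enn2ereal (\<integral>\<^sup>+x. e2ennreal (f x) \<partial>M) - enn2ereal (\<integral>\<^sup>+x. e2ennreal (- f x) \<partial>M)"

definition circle_mean :: "(complex \<Rightarrow> ereal) \<Rightarrow> complex \<Rightarrow> real \<Rightarrow> ereal" where
  "circle_mean u z r =
     ereal_integral (restrict_space lborel {0..2*pi}) (\<lambda>t. u (z + of_real r * cis t))
       / ereal (2*pi)"

definition subharmonic :: "(complex \<Rightarrow> ereal) \<Rightarrow> bool" where
  "subharmonic u \<longleftrightarrow>
     usc u \<and> (\<forall>z. u z < \<infinity>) \<and> (\<forall>z. \<forall>r>0. u z \<le> circle_mean u z r)"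

definition plurisubharmonic :: "(complex ^ 'n::finite \<Rightarrow> ereal) \<Rightarrow> bool" where
  "plurisubharmonic u \<longleftrightarrow>
     usc u \<and> (\<forall>z. u z < \<infinity>) \<and> (\<forall>a b. subharmonic (\<lambda>\<zeta>. u (a + \<zeta> *s b)))"

definition polar :: "complex set \<Rightarrow> bool" where
  "polar E \<longleftrightarrow>
     (\<exists>u. subharmonic u \<and> (\<exists>z. u z \<noteq> -\<infinity>) \<and> (\<forall>z\<in>E. u z = -\<infinity>))"

definition supporting_function :: "(real ^ 'n::finite) set \<Rightarrow> real ^ 'n \<Rightarrow> real" where
  "supporting_function S \<xi> = (SUP x\<in>S. x \<bullet> \<xi>)"

definition cstar :: "(complex ^ 'n::finite) set" where
  "cstar = {z. \<forall>i. z $ i \<noteq> 0}"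

text \<open>On \<open>cstar\<close> the function is continuous (for compact \<open>S\<close>), so the upper limit is
  only needed off \<open>cstar\<close>.\<close>

definition log_supporting_function ::
  "(real ^ 'n::finite) set \<Rightarrow> complex ^ 'n \<Rightarrow> ereal" where
  "log_supporting_function S z =
     (let h = (\<lambda>w. ereal (supporting_function S (\<chi> i. ln (norm (w $ i)))))
      in if z \<in> cstar then h z else Limsup (at z within cstar) h)"

definition lelong_class :: "(real ^ 'n::finite) set \<Rightarrow> (complex ^ 'n \<Rightarrow> ereal) set" where
  "lelong_class S =
     {u. plurisubharmonic u \<and>
         (\<exists>c::real. \<forall>z. u z \<le> log_supporting_function S z + ereal c)}"

definition siciak_zakharyuta ::
  "(real ^ 'n::finite) set \<Rightarrow> (complex ^ 'n) set \<Rightarrow> complex ^ 'n \<Rightarrow> ereal" where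
  "siciak_zakharyuta S K z = (SUP u\<in>{u \<in> lelong_class S. \<forall>w\<in>K. u w \<le> 0}. u z)"

text \<open>The one-variable case \<open>S = [0,1]\<close> is stated on \<open>complex\<close> rather than \<open>complex ^ 1\<close>;
  here \<open>log\<^sup>+\<close> at \<open>0\<close> is \<open>0\<close> because \<open>ln 0 = 0\<close>.\<close>

definition lelong_class1 :: "(complex \<Rightarrow> ereal) set" where
  "lelong_class1 =
     {u. subharmonic u \<and> (\<exists>c::real. \<forall>\<zeta>. u \<zeta> \<le> ereal (max 0 (ln (norm \<zeta>)) + c))}"

definition siciak_zakharyuta1 :: "complex set \<Rightarrow> complex \<Rightarrow> ereal" where
  "siciak_zakharyuta1 L z = (SUP u\<in>{u \<in> lelong_class1. \<forall>w\<in>L. u w \<le> 0}. u z)"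

text \<open>Meant for \<open>x \<in> [0, \<infinity>]\<close> and \<open>q > 0\<close>.\<close>

definition ereal_powr :: "ereal \<Rightarrow> real \<Rightarrow> ereal" where
  "ereal_powr x q = (if x = \<infinity> then \<infinity> else ereal (real_of_ereal x powr q))"

definition lp_norm :: "real \<Rightarrow> real ^ 'n::finite \<Rightarrow> real" where
  "lp_norm p x = (\<Sum>i\<in>UNIV. \<bar>x $ i\<bar> powr p) powr (1 / p)"

end

theory Submission
  imports Defs "HOL-Complex_Analysis.Cauchy_Integral_Formula"
    "HOL-Computational_Algebra.Fundamental_Theorem_Algebra"
begin

text \<open>
  Write \<open>V j\<close> for the one-variable extremal function of \<open>K j\<close> at \<open>z j\<close> and \<open>\<phi>\<close> for the supporting function
  of \<open>S\<close>. The identity says that the extremal function of the product is \<open>\<phi> (V 1, ..., V n)\<close>, since on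
  vectors with nonnegative entries the supporting function of the positive part of the \<open>p\<close>-ball is the
  \<open>q\<close>-norm (lemma \<open>supporting_function_lp_ball\<close>).

  Lower bound. For \<open>x\<close> in \<open>S\<close> and one-variable competitors \<open>u j\<close>, the sum of the \<open>x j * max 0 (u j (z j))\<close>
  is a competitor for the product; one takes suprema over the \<open>u j\<close> and then over \<open>x\<close>
  (\<open>siciak_zakharyuta_product_ge\<close>). This also settles the case in which some \<open>V j\<close> is infinite.

  Upper bound. Were the complement of each \<open>K j\<close> the exterior of a disc under a conformal map, the
  disc through \<open>z\<close> along which all \<open>V j\<close> grow proportionally would reduce the claim to one variable.
  In general the level curves of \<open>V j\<close> have critical points and no such disc exists. Two devices
  replace it.

  First, Hilbert's lemniscate theorem (\<open>hilbert_lemniscate\<close>) encloses \<open>K j\<close>, together with the bounded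
  components of its complement, in lemniscates of polynomials \<open>F j\<close> that stay in a given neighbourhood of
  this set. Its proof uses Fekete points and Lagrange interpolation. The positive part of \<open>ln \<bar>F j\<bar> / degree (F j)\<close> is a competitor
  for \<open>K j\<close>, so it is at most \<open>V j\<close>.

  Second, the maximum principle along a disc is replaced by a penalised maximum principle on the
  polyhedra \<open>\<bar>F j\<bar> \<le> exp (l j * \<sigma>)\<close> (\<open>hadamard_lemniscate\<close>): the supremum of a plurisubharmonic function over
  them is bounded by linear interpolation in \<open>\<sigma>\<close>. With \<open>l j = degree (F j) * V j\<close>, up to a small
  error, a competitor is small at \<open>\<sigma> = 0\<close> and at most \<open>T * \<phi> (V 1, ..., V n) + O(1)\<close> at \<open>\<sigma> = T\<close>, while \<open>z\<close>
  belongs to \<open>\<sigma> = 1\<close>. Letting \<open>T\<close> tend to infinity gives the bound (\<open>siciak_zakharyuta_product_le\<close>).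
\<close>

section \<open>Circle means\<close>

text \<open>
  Cauchy's formula for the centre of a circle, with the contour integral written out in the
  parametrisation that \<open>circle_mean\<close> uses.
\<close>

lemma holomorphic_circle_mean_value:
  fixes f :: "complex \<Rightarrow> complex"
  assumes "f holomorphic_on cball z r" and "r > 0"
  shows "((\<lambda>t. f (z + of_real r * cis t)) has_integral of_real (2*pi) * f z) {0..2*pi}"
proof -
  have "((\<lambda>u. f u/(u-z)) has_contour_integral (2 * of_real pi * \<i> * f z)) (circlepath z r)"
    using Cauchy_integral_circlepath_simple[OF assms(1)] assms(2) by simp
  then have "((\<lambda>t. f (z + of_real r * cis t) / (z + of_real r * cis t - z) * of_real r * \<i> * cis t)
      has_integral (2 * of_real pi * \<i> * f z)) {0..2*pi}"
    unfolding circlepath_def by (subst (asm) has_contour_integral_part_circlepath_iff) auto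
  moreover have "f (z + of_real r * cis t) / (z + of_real r * cis t - z) * of_real r * \<i> * cis t
      = \<i> * f (z + of_real r * cis t)" for t
    using assms(2) by (simp add: field_simps)
  ultimately have "((\<lambda>t. \<i> * f (z + of_real r * cis t)) has_integral (2 * of_real pi * \<i> * f z)) {0..2*pi}"
    by (simp only:)
  from has_integral_mult_right[OF this, of "-\<i>"] show ?thesis
    by (simp add: algebra_simps)
qed

lemma ereal_integral_mono:
  assumes "\<And>x. x \<in> space M \<Longrightarrow> f x \<le> g x"
  shows "ereal_integral M f \<le> ereal_integral M g"
  unfolding ereal_integral_def
  by (intro ereal_minus_mono) (auto simp: less_eq_ennreal.rep_eq[symmetric]
      intro!: nn_integral_mono e2ennreal_mono assms)

lemma circle_mean_mono:
  assumes "\<And>t. t \<in> {0..2*pi} \<Longrightarrow> u (z + of_real r * cis t) \<le> v (w + of_real s * cis t)"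
  shows "circle_mean u z r \<le> circle_mean v w s"
  unfolding circle_mean_def
  by (intro ereal_divide_right_mono ereal_integral_mono) (use assms in \<open>auto simp: space_restrict_space\<close>)

lemma ereal_integral_integrable:
  assumes "integrable M (g :: _ \<Rightarrow> real)"
  shows "ereal_integral M (\<lambda>x. ereal (g x)) = ereal (integral\<^sup>L M g)"
proof -
  have fin: "(\<integral>\<^sup>+x. ennreal (g x) \<partial>M) \<noteq> \<infinity>" "(\<integral>\<^sup>+x. ennreal (- g x) \<partial>M) \<noteq> \<infinity>"
    using assms by (auto simp: real_integrable_def)
  show ?thesis
    unfolding ereal_integral_def real_lebesgue_integral_def[OF assms] e2ennreal_ereal uminus_ereal.simps
    using fin by (cases "\<integral>\<^sup>+x. ennreal (g x) \<partial>M"; cases "\<integral>\<^sup>+x. ennreal (- g x) \<partial>M") auto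
qed

lemma circle_mean_continuous:
  assumes "continuous_on {0..2*pi} g"
    and "\<And>t. t \<in> {0..2*pi} \<Longrightarrow> u (z + of_real r * cis t) = ereal (g t)"
  shows "circle_mean u z r = ereal (integral {0..2*pi} g / (2*pi))"
proof -
  let ?M = "restrict_space lborel {0..2*pi}"
  have si: "set_integrable lborel {0..2*pi} g"
    by (rule borel_integrable_atLeastAtMost') (rule assms(1))
  then have int: "integrable ?M g"
    by (subst integrable_restrict_space) (auto simp: set_integrable_def)
  have "integral\<^sup>L ?M g = integral {0..2*pi} g"
    using set_borel_integral_eq_integral(2)[OF si]
    by (subst integral_restrict_space) (auto simp: set_lebesgue_integral_def)
  moreover have "ereal_integral ?M (\<lambda>t. u (z + of_real r * cis t)) = ereal_integral ?M (\<lambda>t. ereal (g t))"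
    by (intro antisym ereal_integral_mono) (auto simp: assms(2) space_restrict_space)
  ultimately show ?thesis
    unfolding circle_mean_def by (simp add: ereal_integral_integrable[OF int])
qed

text \<open>
  The form in which the sub-mean value inequality is used below: the real part of a holomorphic
  function equals its own circle mean, so a bound by it passes from the circle to the centre.
  Harmonic majorants with a small negative constant added thus contradict a maximum at the centre.
\<close>

lemma subharmonic_le_Re_holomorphic:
  assumes v: "subharmonic v" and r: "r > 0" and A: "A holomorphic_on cball z r"
    and le: "\<And>\<zeta>. dist z \<zeta> = r \<Longrightarrow> v \<zeta> \<le> ereal (Re (A \<zeta>))"
  shows "v z \<le> ereal (Re (A z))"
proof -
  let ?g = "\<lambda>t. Re (A (z + of_real r * cis t))"
  have cont: "continuous_on {0..2*pi} ?g"
    by (intro continuous_intros continuous_on_compose2[OF holomorphic_on_imp_continuous_on[OF A]])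
      (use r in \<open>auto simp: dist_norm norm_mult\<close>)
  have "(?g has_integral 2*pi * Re (A z)) {0..2*pi}"
    using has_integral_Re[OF holomorphic_circle_mean_value[OF A r]] by simp
  then have i: "integral {0..2*pi} ?g = 2*pi * Re (A z)"
    by (rule integral_unique)
  have "v z \<le> circle_mean v z r"
    using v r by (auto simp: subharmonic_def)
  also have "\<dots> \<le> circle_mean (\<lambda>\<zeta>. ereal (Re (A \<zeta>))) z r"
    by (intro circle_mean_mono le) (use r in \<open>auto simp: dist_norm norm_mult\<close>)
  also have "\<dots> = ereal (integral {0..2*pi} ?g / (2*pi))"
    by (intro circle_mean_continuous cont) auto
  also have "\<dots> = ereal (Re (A z))"
    using i by simp
  finally show ?thesis .
qed

section \<open>Upper semicontinuous functions\<close>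

lemma usc_nhds:
  assumes "usc u" "u x < c"
  shows "eventually (\<lambda>y. u y < c) (nhds x)"
  using assms by (auto simp: usc_def eventually_nhds)

lemma usc_iff_nhds: "usc u \<longleftrightarrow> (\<forall>x c. u x < c \<longrightarrow> eventually (\<lambda>y. u y < c) (nhds x))"
proof
  assume "usc u"
  then show "\<forall>x c. u x < c \<longrightarrow> eventually (\<lambda>y. u y < c) (nhds x)" by (blast intro: usc_nhds)
next
  assume *: "\<forall>x c. u x < c \<longrightarrow> eventually (\<lambda>y. u y < c) (nhds x)"
  show "usc u"
    unfolding usc_def
  proof
    fix c
    show "open {x. u x < c}"
    proof (subst open_subopen, intro ballI)
      fix x assume "x \<in> {x. u x < c}"
      with * have "eventually (\<lambda>y. u y < c) (nhds x)" by blast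
      then show "\<exists>T. open T \<and> x \<in> T \<and> T \<subseteq> {x. u x < c}" unfolding eventually_nhds by auto
    qed
  qed
qed

lemma usc_compose:
  assumes "usc u" "continuous_on UNIV f"
  shows "usc (\<lambda>x. u (f x))"
  unfolding usc_def
proof
  fix c
  have "open (f -` {x. u x < c})"
    using assms by (intro open_vimage) (auto simp: usc_def)
  then show "open {x. u (f x) < c}" by (simp add: vimage_def)
qed

lemma usc_add_continuous:
  fixes r :: "'a::t2_space \<Rightarrow> real"
  assumes "usc u" "\<And>x. u x < \<infinity>" "continuous_on UNIV r"
  shows "usc (\<lambda>x. u x + ereal (r x))"
  unfolding usc_iff_nhds
proof (intro allI impI)
  fix x c assume less: "u x + ereal (r x) < c"
  show "eventually (\<lambda>y. u y + ereal (r y) < c) (nhds x)"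
  proof (cases c)
    case (real c')
    have "u x < ereal (c' - r x)"
      using less real by (cases "u x") auto
    then obtain d where d: "u x < ereal d" "ereal d < ereal (c' - r x)"
      using ereal_dense2 by blast
    have "isCont r x" using assms(3) by (simp add: continuous_on_eq_continuous_at)
    then have "(r \<longlongrightarrow> r x) (nhds x)" unfolding isCont_def tendsto_at_iff_tendsto_nhds .
    then have "eventually (\<lambda>y. r y < c' - d) (nhds x)"
      using d(2) by (intro order_tendstoD(2)) auto
    with usc_nhds[OF assms(1) d(1)] show ?thesis
    proof eventually_elim
      case (elim y)
      then show ?case using real by (cases "u y") auto
    qed
  next
    case PInf
    then show ?thesis using assms(2) by (auto simp: less_le)
  next
    case MInf
    then show ?thesis using less by simp
  qed
qed

text \<open>
  If no point were a maximum, the sets where the function lies below one of its own values would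
  cover \<open>X\<close>; the largest value belonging to a finite subcover is then not covered.
\<close>

lemma usc_attains_sup:
  assumes w: "usc w" and X: "compact X" "X \<noteq> {}"
  shows "\<exists>x\<in>X. \<forall>y\<in>X. w y \<le> w x"
proof (rule ccontr)
  assume "\<not> ?thesis"
  then have "X \<subseteq> (\<Union>y\<in>X. {x. w x < w y})" by (auto simp: not_le)
  moreover have "open {x. w x < w y}" for y using w by (simp add: usc_def)
  ultimately obtain D where D: "D \<subseteq> X" "finite D" "X \<subseteq> (\<Union>y\<in>D. {x. w x < w y})"
    using compactE_image[OF X(1), of X "\<lambda>y. {x. w x < w y}"] by metis
  then have "D \<noteq> {}" using X(2) by auto
  then obtain y where y: "y \<in> D" "w y = Max (w ` D)"
    using Max_in[of "w ` D"] D(2) by (metis (no_types, lifting) finite_imageI image_iff image_is_empty)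
  then obtain y' where "y' \<in> D" "w y < w y'" using D by auto
  then show False using y D(2) by (simp add: leD)
qed

lemma compact_vec_product:
  fixes K :: "'n::finite \<Rightarrow> ('a::euclidean_space) set"
  assumes "\<And>j. compact (K j)"
  shows "compact {w :: 'a ^ 'n. \<forall>j. w $ j \<in> K j}"
proof -
  have "closed {w :: 'a ^ 'n. \<forall>j. w $ j \<in> K j}"
  proof (intro closed_Collect_all)
    fix j
    have "closed ((\<lambda>w :: 'a ^ 'n. w $ j) -` K j)"
      by (intro closed_vimage compact_imp_closed assms continuous_intros)
    then show "closed {w :: 'a ^ 'n. w $ j \<in> K j}" by (simp add: vimage_def)
  qed
  moreover have "bounded {w :: 'a ^ 'n. \<forall>j. w $ j \<in> K j}"
  proof -
    have "\<forall>j. \<exists>b. \<forall>x\<in>K j. norm x \<le> b"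
      using compact_imp_bounded[OF assms] unfolding bounded_iff by blast
    then obtain b where b: "\<And>j x. x \<in> K j \<Longrightarrow> norm x \<le> b j" by metis
    have "norm w \<le> sum b UNIV" if "\<forall>j. w $ j \<in> K j" for w :: "'a ^ 'n"
    proof -
      have "norm w \<le> (\<Sum>j\<in>UNIV. norm (w $ j))"
        unfolding norm_vec_def by (rule L2_set_le_sum) simp
      also have "\<dots> \<le> sum b UNIV" using that b by (intro sum_mono) auto
      finally show ?thesis .
    qed
    then show ?thesis by (auto simp: bounded_iff)
  qed
  ultimately show ?thesis by (simp add: compact_eq_bounded_closed)
qed

lemma compact_poly_sublevel:
  fixes p :: "complex poly"
  assumes "degree p > 0"
  shows "compact {x. norm (poly p x) \<le> c}"
proof -
  obtain a q where p: "p = pCons a q" by (cases p) auto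
  with assms have "q \<noteq> 0" by auto
  from poly_infinity[OF this, of "c + 1" a] obtain r where
    r: "\<And>z. r \<le> norm z \<Longrightarrow> c + 1 \<le> norm (poly p z)" using p by auto
  have "bounded {x. norm (poly p x) \<le> c}"
    unfolding bounded_iff
  proof (intro exI ballI)
    fix x assume "x \<in> {x. norm (poly p x) \<le> c}"
    then show "norm x \<le> r" using r[of x] by (cases "r \<le> norm x") auto
  qed
  moreover have "closed {x. norm (poly p x) \<le> c}"
    by (intro closed_Collect_le continuous_intros)
  ultimately show ?thesis by (simp add: compact_eq_bounded_closed)
qed

section \<open>The maximum principle along curves\<close>

lemma holomorphic_quadratic_error:
  assumes "E holomorphic_on UNIV" "deriv E 0 = 0"
  shows "\<exists>C. \<forall>\<zeta>. norm \<zeta> \<le> 1 \<longrightarrow> norm (E \<zeta> - E 0) \<le> C * norm \<zeta> ^ 2"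
proof -
  have hol: "(deriv ^^ i) E holomorphic_on UNIV" for i
    using holomorphic_higher_deriv[OF assms(1)] by simp
  have "bounded ((deriv ^^ 2) E ` cball 0 1)"
    by (intro compact_imp_bounded compact_continuous_image continuous_on_subset
        [OF holomorphic_on_imp_continuous_on[OF hol]]) auto
  then obtain B where B: "\<And>x. x \<in> cball 0 1 \<Longrightarrow> norm ((deriv ^^ 2) E x) \<le> B"
    unfolding bounded_iff by blast
  have "norm (E \<zeta> - E 0) \<le> B * norm \<zeta> ^ 2" if z: "norm \<zeta> \<le> 1" for \<zeta>
  proof -
    have "norm ((deriv ^^ 0) E \<zeta> - (\<Sum>i\<le>1. (deriv ^^ i) E 0 * (\<zeta> - 0) ^ i / fact i))
            \<le> B * norm (\<zeta> - 0) ^ Suc 1 / fact 1"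
    proof (rule field_Taylor[of "cball 0 1" 1 "\<lambda>i. (deriv ^^ i) E"])
      fix i x
      show "((deriv ^^ i) E has_field_derivative (deriv ^^ Suc i) E x) (at x within cball 0 1)"
        using holomorphic_derivI[OF hol[of i], of x] by (auto intro: has_field_derivative_at_within)
    qed (use B z in \<open>auto simp: numeral_2_eq_2\<close>)
    then show ?thesis using assms(2) by (simp add: numeral_2_eq_2)
  qed
  then show ?thesis by blast
qed

text \<open>
  The local step of the maximum argument. Suppose that \<open>v\<close> plus the bracketed real function has a
  local maximum at \<open>0\<close>. On a circle of radius \<open>r\<close> the bracket is, up to a constant, the real part of a
  holomorphic function plus \<open>\<eta> r\<^sup>2 / 2\<close>, the contribution of \<open>(Re \<zeta>)\<^sup>2\<close>, with an error that comes only
  from the \<open>E j\<close>. Because \<open>E j\<close> has vanishing derivative, \<open>\<bar>E j\<bar>\<^sup>2\<close> differs from a harmonic function by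
  \<open>\<bar>E j - E j 0\<bar>\<^sup>2\<close>, which is of order \<open>r\<^sup>4\<close> and loses against \<open>\<eta> r\<^sup>2 / 2\<close>. So the value of \<open>v\<close> at the
  centre drops strictly below the maximum.
\<close>

lemma subharmonic_below_penalised_max:
  fixes v :: "complex \<Rightarrow> ereal" and E :: "'j \<Rightarrow> complex \<Rightarrow> complex"
  assumes v: "subharmonic v" and J: "finite J"
    and g: "g holomorphic_on UNIV" "g 0 \<noteq> 0"
    and E: "\<And>j. j \<in> J \<Longrightarrow> E j holomorphic_on UNIV" "\<And>j. j \<in> J \<Longrightarrow> deriv (E j) 0 = 0"
    and eta: "\<eta> > 0"
    and ev: "eventually (\<lambda>\<zeta>. v \<zeta> + ereal (\<delta> * ln (norm (g \<zeta>)) + \<kappa> * Re \<zeta> + \<eta> * (Re \<zeta>)\<^sup>2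
                  - (\<Sum>j\<in>J. (norm (E j \<zeta>))\<^sup>2))
               \<le> ereal (v0 + \<delta> * ln (norm (g 0)) - (\<Sum>j\<in>J. (norm (E j 0))\<^sup>2))) (nhds 0)"
  shows "v 0 < ereal v0"
proof -
  have "\<forall>j\<in>J. \<exists>C. \<forall>\<zeta>. norm \<zeta> \<le> 1 \<longrightarrow> norm (E j \<zeta> - E j 0) \<le> C * norm \<zeta> ^ 2"
    using holomorphic_quadratic_error E by blast
  then obtain C where C: "\<And>j \<zeta>. j \<in> J \<Longrightarrow> norm \<zeta> \<le> 1 \<Longrightarrow> norm (E j \<zeta> - E j 0) \<le> C j * norm \<zeta> ^ 2"
    by metis
  define D where "D = (\<Sum>j\<in>J. (C j)\<^sup>2)"
  have D0: "D \<ge> 0" unfolding D_def by (intro sum_nonneg) auto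
  have gc: "isCont g 0"
    using holomorphic_on_imp_continuous_on[OF g(1)] by (simp add: continuous_on_eq_continuous_at)
  then have "isCont (\<lambda>\<zeta>. g \<zeta> / g 0) 0" by (intro continuous_intros) (use g in auto)
  then have "((\<lambda>\<zeta>. g \<zeta> / g 0) \<longlongrightarrow> g 0 / g 0) (nhds 0)"
    unfolding isCont_def by (rule tendsto_at_iff_tendsto_nhds[where g = "\<lambda>\<zeta>. g \<zeta> / g 0", THEN iffD1])
  then have "((\<lambda>\<zeta>. g \<zeta> / g 0) \<longlongrightarrow> 1) (nhds 0)"
    using g by simp
  then have "eventually (\<lambda>\<zeta>. dist (g \<zeta> / g 0) 1 < 1) (nhds 0)"
    by (rule tendstoD) simp
  from eventually_conj[OF ev this] obtain \<rho> where \<rho>: "\<rho> > 0"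
    and ev': "\<And>\<zeta>. dist \<zeta> 0 < \<rho> \<Longrightarrow> v \<zeta> + ereal (\<delta> * ln (norm (g \<zeta>)) + \<kappa> * Re \<zeta> + \<eta> * (Re \<zeta>)\<^sup>2
                  - (\<Sum>j\<in>J. (norm (E j \<zeta>))\<^sup>2))
               \<le> ereal (v0 + \<delta> * ln (norm (g 0)) - (\<Sum>j\<in>J. (norm (E j 0))\<^sup>2))"
    and g1: "\<And>\<zeta>. dist \<zeta> 0 < \<rho> \<Longrightarrow> dist (g \<zeta> / g 0) 1 < 1"
    unfolding eventually_nhds_metric by blast
  define r where "r = Min {\<rho> / 2, 1, \<eta> / (2 * (2 * D + 1))}"
  have r: "r > 0" "r < \<rho>" "r \<le> 1" "r \<le> \<eta> / (2 * (2 * D + 1))"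
    using \<rho> eta D0 by (auto simp: r_def min_less_iff_disj)
  define A where "A = (\<lambda>\<zeta>. of_real (v0 - \<eta> * r\<^sup>2 / 2 + D * r^4)
      - of_real \<delta> * Ln (g \<zeta> / g 0) - of_real \<kappa> * \<zeta> - of_real (\<eta>/2) * \<zeta>\<^sup>2
      + 2 * (\<Sum>j\<in>J. cnj (E j 0) * (E j \<zeta> - E j 0)))"
  have nonpos: "g \<zeta> / g 0 \<notin> \<real>\<^sub>\<le>\<^sub>0" if "dist \<zeta> 0 < \<rho>" for \<zeta>
  proof
    assume a: "g \<zeta> / g 0 \<in> \<real>\<^sub>\<le>\<^sub>0"
    have "\<bar>Re (g \<zeta> / g 0 - 1)\<bar> < 1"
      using g1[OF that] abs_Re_le_cmod[of "g \<zeta> / g 0 - 1"] by (simp add: dist_norm)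
    then show False using a by (auto simp: complex_nonpos_Reals_iff)
  qed
  have hol: "A holomorphic_on cball 0 r"
    unfolding A_def
    by (intro holomorphic_intros holomorphic_on_subset[OF g(1)] holomorphic_on_subset[OF E(1)])
      (use nonpos r g in auto)
  have "v 0 \<le> ereal (Re (A 0))"
  proof (rule subharmonic_le_Re_holomorphic[OF v r(1) hol])
    fix \<zeta> :: complex assume "dist 0 \<zeta> = r"
    then have nz: "norm \<zeta> = r" "dist \<zeta> 0 < \<rho>" using r by (auto simp: dist_norm)
    have gz: "g \<zeta> \<noteq> 0" using nonpos[OF nz(2)] by auto
    have lnR: "ln (norm (g \<zeta>)) - ln (norm (g 0)) = Re (Ln (g \<zeta> / g 0))"
      using gz g(2) by (simp add: norm_divide ln_div)
    have sqE: "(norm (E j \<zeta>))\<^sup>2 - (norm (E j 0))\<^sup>2 \<le> 2 * Re (cnj (E j 0) * (E j \<zeta> - E j 0)) + (C j)\<^sup>2 * r^4"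
      if j: "j \<in> J" for j
    proof -
      have "(norm (E j \<zeta>))\<^sup>2 - (norm (E j 0))\<^sup>2
          = 2 * Re (cnj (E j 0) * (E j \<zeta> - E j 0)) + (norm (E j \<zeta> - E j 0))\<^sup>2"
        unfolding cmod_power2 by (simp add: power2_eq_square algebra_simps)
      moreover have "(norm (E j \<zeta> - E j 0))\<^sup>2 \<le> (C j * r\<^sup>2)\<^sup>2"
        using C[OF j, of \<zeta>] nz r by (intro power_mono) auto
      ultimately show ?thesis by (simp add: power_mult_distrib)
    qed
    have "(\<Sum>j\<in>J. (norm (E j \<zeta>))\<^sup>2) - (\<Sum>j\<in>J. (norm (E j 0))\<^sup>2)
      \<le> (\<Sum>j\<in>J. 2 * Re (cnj (E j 0) * (E j \<zeta> - E j 0)) + (C j)\<^sup>2 * r^4)"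
      unfolding sum_subtractf[symmetric] by (intro sum_mono sqE)
    also have "\<dots> = 2 * (\<Sum>j\<in>J. Re (cnj (E j 0) * (E j \<zeta> - E j 0))) + D * r^4"
      by (simp only: sum.distrib D_def sum_distrib_left sum_distrib_right)
    finally have sE: "(\<Sum>j\<in>J. (norm (E j \<zeta>))\<^sup>2) - (\<Sum>j\<in>J. (norm (E j 0))\<^sup>2)
      \<le> 2 * (\<Sum>j\<in>J. Re (cnj (E j 0) * (E j \<zeta> - E j 0))) + D * r^4" .
    have re2: "(Re \<zeta>)\<^sup>2 = (r\<^sup>2 + Re (\<zeta>\<^sup>2)) / 2"
      unfolding nz(1)[symmetric] cmod_power2 by (simp add: power2_eq_square)
    have ReA: "Re (A \<zeta>) = v0 - \<eta> * r\<^sup>2 / 2 + D * r^4 - \<delta> * Re (Ln (g \<zeta> / g 0)) - \<kappa> * Re \<zeta>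
        - \<eta>/2 * Re (\<zeta>\<^sup>2) + 2 * (\<Sum>j\<in>J. Re (cnj (E j 0) * (E j \<zeta> - E j 0)))"
    proof -
      have "Re (of_real x - of_real \<delta> * L - of_real \<kappa> * \<zeta> - of_real h * Q + 2 * S)
          = x - \<delta> * Re L - \<kappa> * Re \<zeta> - h * Re Q + 2 * Re S" for x h L Q S
        by simp
      from this[of "v0 - \<eta> * r\<^sup>2 / 2 + D * r^4" "Ln (g \<zeta> / g 0)" "\<eta>/2" "\<zeta>\<^sup>2"
          "\<Sum>j\<in>J. cnj (E j 0) * (E j \<zeta> - E j 0)"]
      show ?thesis unfolding A_def Re_sum .
    qed
    have "v \<zeta> \<le> ereal (v0 + \<delta> * ln (norm (g 0)) - (\<Sum>j\<in>J. (norm (E j 0))\<^sup>2)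
        - (\<delta> * ln (norm (g \<zeta>)) + \<kappa> * Re \<zeta> + \<eta> * (Re \<zeta>)\<^sup>2 - (\<Sum>j\<in>J. (norm (E j \<zeta>))\<^sup>2)))"
      using ev'[OF nz(2)] by (cases "v \<zeta>") auto
    also have "\<dots> \<le> ereal (Re (A \<zeta>))"
    proof -
      have "\<eta> * ((r\<^sup>2 + Re (\<zeta>\<^sup>2)) / 2) = \<eta> * r\<^sup>2 / 2 + \<eta>/2 * Re (\<zeta>\<^sup>2)"
        by (simp add: field_simps)
      then show ?thesis
        unfolding ereal_less_eq ReA lnR[symmetric] re2 right_diff_distrib[of \<delta>] using sE by linarith
    qed
    finally show "v \<zeta> \<le> ereal (Re (A \<zeta>))" .
  qed
  also have "Re (A 0) = v0 - r\<^sup>2 * (\<eta> / 2 - D * r\<^sup>2)"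
    using g(2) by (simp add: A_def algebra_simps flip: power_add)
  also have "ereal \<dots> < ereal v0"
  proof -
    have "D * r\<^sup>2 \<le> D * r" using r D0 by (intro mult_left_mono) (auto simp: power2_eq_square mult_left_le)
    also have "\<dots> \<le> (2 * D + 1) * r / 2" using r by (simp add: algebra_simps)
    also have "\<dots> \<le> \<eta> / 4" using r(4) D0 by (simp add: field_simps)
    finally have "\<eta> / 2 - D * r\<^sup>2 > 0" using eta by simp
    then show ?thesis using r(1) by simp
  qed
  finally show ?thesis .
qed

section \<open>A Hadamard inequality for lemniscate polyhedra\<close>

lemma plurisubharmonic_line:
  "plurisubharmonic u \<Longrightarrow> subharmonic (\<lambda>\<zeta>. u (a + \<zeta> *s b))"
  by (simp add: plurisubharmonic_def)

lemma plurisubharmonic_usc: "plurisubharmonic u \<Longrightarrow> usc u"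
  and plurisubharmonic_less_infinity: "plurisubharmonic u \<Longrightarrow> u z < \<infinity>"
  by (simp_all add: plurisubharmonic_def)

text \<open>
  A three-circles inequality along the family of polyhedra
  \<open>\<bar>F j (w j)\<bar> \<le> exp (l j * \<sigma>)\<close>, \<open>0 \<le> \<sigma> \<le> T\<close>: a bound for \<open>u\<close> on the innermost and on the outermost
  one interpolates linearly in \<open>\<sigma>\<close>. The two bounds are required with a factor \<open>2\<close> to spare, because
  the penalty below enforces the constraints only up to such a factor.

  If it fails at \<open>(z, s)\<close>, one maximises over \<open>(w, \<sigma>)\<close> the excess of \<open>u w\<close> over the linear interpolant,
  minus the penalty \<open>\<Sum>j. (\<bar>F j (w j)\<bar> exp (- l j * \<sigma>)) ^ (2 M)\<close>. For large \<open>M\<close> the penalty is negligible at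
  \<open>(z, s)\<close> and prohibitive as soon as some factor reaches \<open>2\<close>, which ties \<open>w\<close> to \<open>\<sigma>\<close> and makes the two
  boundary bounds applicable at \<open>\<sigma> = 0\<close> and \<open>\<sigma> = T\<close>. At an interior maximum \<open>(w0, \<sigma>0)\<close> one moves along
  \<open>(w0 + \<zeta> \<beta>, \<sigma>0 + Re \<zeta>)\<close>, with \<open>\<beta>\<close> chosen so that the holomorphic function
  \<open>F j (w0 j + \<zeta> \<beta> j) exp (- l j (\<sigma>0 + \<zeta>))\<close> is stationary at \<open>\<zeta> = 0\<close>. The penalty is then harmonic up to
  fourth order, and a small term \<open>\<eta> \<sigma>\<^sup>2\<close> yields a contradiction. Only straight lines occur, so the
  definition of plurisubharmonicity suffices and no composition with curved discs is needed.

  The direction \<open>\<beta>\<close> exists only where the derivatives of the \<open>F j\<close> do not vanish. A small multiple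
  of \<open>ln \<bar>f\<bar>\<close>, where \<open>f\<close> is the product of these derivatives, pushes the maximum away from their zeros.
\<close>

lemma hadamard_noncritical:
  fixes u :: "complex ^ 'n::finite \<Rightarrow> ereal" and F :: "'n \<Rightarrow> complex poly"
  assumes psh: "plurisubharmonic u"
    and deg: "\<And>j. degree (F j) > 0" and l: "\<And>j. l j > 0" and s: "0 < s" "s < T"
    and a: "\<And>w. (\<And>j. norm (poly (F j) (w $ j)) \<le> 2) \<Longrightarrow> u w \<le> ereal a"
    and b: "\<And>w. (\<And>j. norm (poly (F j) (w $ j)) \<le> 2 * exp (l j * T)) \<Longrightarrow> u w \<le> ereal b"
    and z: "\<And>j. norm (poly (F j) (z $ j)) < exp (l j * s)"
    and nc: "\<And>j. poly (pderiv (F j)) (z $ j) \<noteq> 0"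
  shows "u z \<le> ereal (a + (b - a) / T * s)"
proof (rule ccontr)
  assume neg: "\<not> ?thesis"
  define \<kappa> where "\<kappa> = (b - a) / T"
  have zB: "norm (poly (F j) (z $ j)) \<le> 2 * exp (l j * T)" for j
  proof -
    have "exp (l j * s) \<le> exp (l j * T)" using l[of j] s by simp
    then show ?thesis using z[of j] exp_gt_zero[of "l j * T"] by linarith
  qed
  from b[OF zB] neg obtain uz where uz: "u z = ereal uz" by (cases "u z") auto
  define \<gamma> where "\<gamma> = uz - (a + \<kappa> * s)"
  have \<gamma>: "\<gamma> > 0" using neg by (simp add: uz \<gamma>_def \<kappa>_def)
  have \<kappa>T: "\<kappa> * T = b - a" using s by (simp add: \<kappa>_def)
  define B where "B = {w :: complex ^ 'n. \<forall>j. w $ j \<in> {x. norm (poly (F j) x) \<le> 2 * exp (l j * T)}}"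
  have B: "compact B" unfolding B_def by (intro compact_vec_product compact_poly_sublevel deg)
  define f where "f = (\<lambda>w :: complex ^ 'n. \<Prod>j\<in>UNIV. poly (pderiv (F j)) (w $ j))"
  have fcont: "continuous_on UNIV f" unfolding f_def by (intro continuous_intros)
  have fz: "f z \<noteq> 0" using nc by (simp add: f_def)
  have "bounded (f ` B)"
    by (intro compact_imp_bounded compact_continuous_image continuous_on_subset[OF fcont] B) auto
  then obtain C' where C': "\<And>w. w \<in> B \<Longrightarrow> norm (f w) \<le> C'" unfolding bounded_iff by blast
  define C1 where "C1 = ln C'"
  have zinB: "z \<in> B" using zB by (simp add: B_def)
  have C'pos: "C' > 0" using C'[OF zinB] fz by (smt (verit) zero_less_norm_iff)
  have C1z: "ln (norm (f z)) \<le> C1" using C'[OF zinB] fz C'pos by (simp add: C1_def)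
  \<comment> \<open>The gap \<open>\<gamma>\<close> is split into quarters, one each for the critical points (\<open>\<delta>\<close>), the quadratic term
    (\<open>\<eta>\<close>) and the penalty at \<open>(z, s)\<close>; the last quarter keeps the final inequalities strict.\<close>
  define \<delta> where "\<delta> = \<gamma> / (4 * (C1 - ln (norm (f z)) + 1))"
  have \<delta>: "\<delta> > 0" using \<gamma> C1z by (simp add: \<delta>_def)
  have \<delta>C: "\<delta> * (C1 - ln (norm (f z))) \<le> \<gamma> / 4"
    using \<gamma> C1z by (simp add: \<delta>_def field_simps)
  define \<eta> where "\<eta> = \<gamma> / (4 * T\<^sup>2)"
  have \<eta>: "\<eta> > 0" using \<gamma> s by (simp add: \<eta>_def)
  have \<eta>T: "\<eta> * T\<^sup>2 = \<gamma> / 4" using s by (simp add: \<eta>_def)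
  define D where "D = \<bar>b\<bar> + \<bar>a\<bar> + \<bar>\<kappa>\<bar> * T + \<gamma> / 4"
  have Dbound: "b - a - \<kappa> * \<sigma> + \<eta> * \<sigma>\<^sup>2 \<le> D" if "0 \<le> \<sigma>" "\<sigma> \<le> T" for \<sigma>
  proof -
    have "\<eta> * \<sigma>\<^sup>2 \<le> \<eta> * T\<^sup>2" using that \<eta> by (intro mult_left_mono power_mono) auto
    moreover have "- (\<kappa> * \<sigma>) \<le> \<bar>\<kappa>\<bar> * T"
    proof -
      have "- (\<kappa> * \<sigma>) \<le> \<bar>\<kappa> * \<sigma>\<bar>" by simp
      also have "\<dots> \<le> \<bar>\<kappa>\<bar> * T" unfolding abs_mult using that by (intro mult_left_mono) auto
      finally show ?thesis .
    qed
    ultimately show ?thesis unfolding D_def \<eta>T by linarith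
  qed
  \<comment> \<open>\<open>S0\<close> bounds the penalised function from below at \<open>(z, s)\<close>. The logarithm is truncated at \<open>ln \<tau>\<close> so that
    it is continuous everywhere; \<open>\<tau>\<close> is so small that no maximum occurs where the truncation acts.\<close>
  define S0 where "S0 = \<delta> * ln (norm (f z)) + 3/4 * \<gamma>"
  define \<tau> where "\<tau> = min (norm (f z)) (exp ((S0 - D - 1) / \<delta>))"
  have \<tau>: "\<tau> > 0" "\<tau> \<le> norm (f z)" using fz by (auto simp: \<tau>_def)
  have "ln \<tau> \<le> (S0 - D - 1) / \<delta>"
  proof -
    have "ln \<tau> \<le> ln (exp ((S0 - D - 1) / \<delta>))"
      using \<tau>(1) by (intro ln_mono) (auto simp: \<tau>_def)
    then show ?thesis by simp
  qed
  then have \<tau>S: "\<delta> * ln \<tau> + D < S0" using \<delta> by (simp add: field_simps)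
  \<comment> \<open>The size of the constraints and the choice of the exponent \<open>M\<close>. Points with \<open>q j w \<sigma> \<ge> 2\<close> pay at
    least \<open>4 ^ M\<close>, whereas \<open>q j z s < 1\<close>.\<close>
  define q where "q = (\<lambda>j (w :: complex ^ 'n) \<sigma>. norm (poly (F j) (w $ j)) * exp (- l j * \<sigma>))"
  have q0: "q j w \<sigma> \<ge> 0" for j w \<sigma> by (simp add: q_def)
  have qz: "q j z s < 1" for j
    using z[of j] by (simp add: q_def exp_minus field_simps)
  have "(\<lambda>M. \<Sum>j\<in>UNIV. ((q j z s)\<^sup>2) ^ M) \<longlonglongrightarrow> (\<Sum>j\<in>(UNIV :: 'n set). 0)"
    using qz q0 by (intro tendsto_sum LIMSEQ_power_zero) (auto simp: power_less_one_iff)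
  then have "eventually (\<lambda>M. (\<Sum>j\<in>UNIV. ((q j z s)\<^sup>2) ^ M) < \<gamma> / 4) sequentially"
    using \<gamma> by (intro order_tendstoD(2)) auto
  moreover have "eventually (\<lambda>M. \<delta> * C1 + D - S0 < 4 ^ M) sequentially"
  proof -
    obtain n where n: "\<delta> * C1 + D - S0 < 4 ^ n"
      using real_arch_pow[of 4] by auto
    have "(4::real) ^ n \<le> 4 ^ M" if "n \<le> M" for M
      using that by (intro power_increasing) auto
    with n show ?thesis unfolding eventually_sequentially by (meson less_le_trans)
  qed
  ultimately have "eventually (\<lambda>M. (\<Sum>j\<in>UNIV. ((q j z s)\<^sup>2) ^ M) < \<gamma> / 4 \<and> \<delta> * C1 + D - S0 < 4 ^ M) sequentially"
    by (rule eventually_conj)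
  then obtain M where M1: "(\<Sum>j\<in>UNIV. ((q j z s)\<^sup>2) ^ M) < \<gamma> / 4" and M2: "\<delta> * C1 + D - S0 < 4 ^ M"
    unfolding eventually_sequentially by blast
  define r where "r = (\<lambda>(w, \<sigma>). \<delta> * ln (max \<tau> (norm (f w))) - a - \<kappa> * \<sigma> + \<eta> * \<sigma>\<^sup>2 - (\<Sum>j\<in>UNIV. ((q j w \<sigma>)\<^sup>2) ^ M))"
  have rcont: "continuous_on UNIV r"
    unfolding r_def q_def case_prod_unfold
    by (intro continuous_intros continuous_on_compose2[OF fcont]) (use \<tau> in auto)
  define X where "X = B \<times> {0..T}"
  have "\<exists>x\<in>X. \<forall>y\<in>X. u (fst y) + ereal (r y) \<le> u (fst x) + ereal (r x)"
  proof (rule usc_attains_sup)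
    show "usc (\<lambda>y. u (fst y) + ereal (r y))"
      by (intro usc_add_continuous rcont usc_compose[OF plurisubharmonic_usc[OF psh]]
          plurisubharmonic_less_infinity[OF psh] continuous_intros)
  qed (use B zinB s in \<open>auto simp: X_def intro!: compact_Times\<close>)
  then obtain w0 \<sigma>0 where w0: "w0 \<in> B" and \<sigma>0: "0 \<le> \<sigma>0" "\<sigma>0 \<le> T"
    and max: "\<And>w \<sigma>. w \<in> B \<Longrightarrow> 0 \<le> \<sigma> \<Longrightarrow> \<sigma> \<le> T \<Longrightarrow>
       u w + ereal (r (w, \<sigma>)) \<le> u w0 + ereal (r (w0, \<sigma>0))"
    by (auto simp: X_def)
  have "S0 \<le> uz + r (z, s)"
  proof -
    have "max \<tau> (norm (f z)) = norm (f z)" using \<tau> by simp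
    then have "r (z, s) = \<delta> * ln (norm (f z)) - a - \<kappa> * s + \<eta> * s\<^sup>2 - (\<Sum>j\<in>UNIV. ((q j z s)\<^sup>2) ^ M)"
      by (simp add: r_def)
    moreover have "\<eta> * s\<^sup>2 \<ge> 0" using \<eta> by simp
    ultimately show ?thesis using M1 \<gamma>_def unfolding S0_def by linarith
  qed
  then have S0: "ereal S0 \<le> u w0 + ereal (r (w0, \<sigma>0))"
    using max[OF zinB, of s] s uz by (metis ereal_less_eq(3) less_eq_real_def order_trans plus_ereal.simps(1))
  have ub: "u w0 \<le> ereal b" using b w0 by (auto simp: B_def)
  obtain U0 where U0: "u w0 = ereal U0" using ub S0 by (cases "u w0") auto
  have S0': "S0 \<le> U0 + r (w0, \<sigma>0)" using S0 by (simp add: U0)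
  have U0b: "U0 \<le> b" using ub U0 by simp
  have qsum: "(\<Sum>j\<in>UNIV. ((q j w0 \<sigma>0)\<^sup>2) ^ M) \<ge> 0" by (intro sum_nonneg) auto
  have lnC1: "ln (max \<tau> (norm (f w0))) \<le> C1"
    unfolding C1_def using C'[OF w0] C'[OF zinB] \<tau> by (intro ln_mono) auto
  have fw0: "norm (f w0) > \<tau>"
  proof (rule ccontr)
    assume "\<not> ?thesis"
    then have "max \<tau> (norm (f w0)) = \<tau>" by simp
    then have "U0 + r (w0, \<sigma>0) \<le> \<delta> * ln \<tau> + (b - a - \<kappa> * \<sigma>0 + \<eta> * \<sigma>0\<^sup>2)"
      using qsum U0b by (simp add: r_def)
    then show False using Dbound[OF \<sigma>0] \<tau>S S0' by linarith
  qed
  have q2: "q j w0 \<sigma>0 < 2" for j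
  proof (rule ccontr)
    assume "\<not> ?thesis"
    then have "(2::real)\<^sup>2 \<le> (q j w0 \<sigma>0)\<^sup>2" by (intro power_mono) auto
    then have "4 ^ M \<le> ((q j w0 \<sigma>0)\<^sup>2) ^ M" by (intro power_mono) auto
    also have "\<dots> \<le> (\<Sum>j\<in>UNIV. ((q j w0 \<sigma>0)\<^sup>2) ^ M)" by (intro member_le_sum) auto
    finally have "U0 + r (w0, \<sigma>0) \<le> \<delta> * C1 + (b - a - \<kappa> * \<sigma>0 + \<eta> * \<sigma>0\<^sup>2) - 4 ^ M"
      using U0b mult_left_mono[OF lnC1, of \<delta>] \<delta> unfolding r_def prod.case by linarith
    then show False using Dbound[OF \<sigma>0] M2 S0' by linarith
  qed
  have qF: "norm (poly (F j) (w0 $ j)) < 2 * exp (l j * \<sigma>0)" for j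
    using q2[of j] by (simp add: q_def exp_minus field_simps)
  have rle: "r (w0, \<sigma>0) \<le> \<delta> * C1 - a - \<kappa> * \<sigma>0 + \<eta> * \<sigma>0\<^sup>2"
    using qsum mult_left_mono[OF lnC1, of \<delta>] \<delta> unfolding r_def prod.case by linarith
  have \<delta>C': "\<delta> * C1 \<le> \<delta> * ln (norm (f z)) + \<gamma> / 4" using \<delta>C by (simp add: algebra_simps)
  have "\<sigma>0 \<noteq> 0"
  proof
    assume 0: "\<sigma>0 = 0"
    then have "u w0 \<le> ereal a" using qF by (intro a) (simp add: less_imp_le)
    then have "U0 \<le> a" by (simp add: U0)
    then show False using rle S0' \<delta>C' \<gamma> unfolding 0 S0_def by simp
  qed
  moreover have "\<sigma>0 \<noteq> T"
  proof
    assume T: "\<sigma>0 = T"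
    have "U0 + r (w0, \<sigma>0) \<le> \<delta> * C1 + (b - a - \<kappa> * T) + \<eta> * T\<^sup>2"
      using rle U0b unfolding T by simp
    then show False using S0' \<delta>C' \<gamma> unfolding \<kappa>T \<eta>T S0_def by simp
  qed
  ultimately have \<sigma>0': "0 < \<sigma>0" "\<sigma>0 < T" using \<sigma>0 by auto
  have fw0': "f w0 \<noteq> 0" using fw0 \<tau> by auto
  then have F'0: "poly (pderiv (F j)) (w0 $ j) \<noteq> 0" for j by (simp add: f_def)
  \<comment> \<open>The maximum is interior and noncritical. Newton's quotient gives the direction along which \<open>F j\<close>
    grows at the same logarithmic rate as \<open>exp (l j * \<sigma>)\<close>.\<close>
  define \<beta> where "\<beta> = (\<chi> j. of_real (l j) * poly (F j) (w0 $ j) / poly (pderiv (F j)) (w0 $ j))"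
  define E where "E = (\<lambda>j \<zeta>. (poly (F j) (w0 $ j + \<zeta> * \<beta> $ j) * exp (- of_real (l j) * (of_real \<sigma>0 + \<zeta>))) ^ M)"
  have normE: "(norm (E j \<zeta>))\<^sup>2 = ((q j (w0 + \<zeta> *s \<beta>) (\<sigma>0 + Re \<zeta>))\<^sup>2) ^ M" for j \<zeta>
  proof -
    have "norm (E j \<zeta>) = (q j (w0 + \<zeta> *s \<beta>) (\<sigma>0 + Re \<zeta>)) ^ M"
      by (simp add: E_def q_def norm_power norm_mult)
    then show ?thesis by (simp flip: power_mult add: mult.commute)
  qed
  have derE: "(E j has_field_derivative 0) (at 0)" for j
  proof -
    define c where "c = exp (- of_real (l j) * (of_real \<sigma>0 :: complex))"
    have "poly (pderiv (F j)) (w0 $ j) * \<beta> $ j * c + poly (F j) (w0 $ j) * (c * (- of_real (l j))) = 0"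
      using F'0[of j] by (simp add: \<beta>_def)
    then have "((\<lambda>\<zeta>. poly (F j) (w0 $ j + \<zeta> * \<beta> $ j) * exp (- of_real (l j) * (of_real \<sigma>0 + \<zeta>)))
       has_field_derivative 0) (at 0)"
      unfolding c_def
      by (auto intro!: derivative_eq_intros DERIV_chain2[OF poly_DERIV] simp: algebra_simps)
    from DERIV_power[OF this, of M] show ?thesis unfolding E_def by simp
  qed
  have "u (w0 + 0 *s \<beta>) < ereal U0"
  proof (rule subharmonic_below_penalised_max[where J = UNIV and E = E and g = "\<lambda>\<zeta>. f (w0 + \<zeta> *s \<beta>)"
        and \<eta> = \<eta> and \<delta> = \<delta> and \<kappa> = "2 * \<eta> * \<sigma>0 - \<kappa>"])
    \<comment> \<open>the linear coefficient combines the interpolant with the expansion of \<open>\<eta> (\<sigma>0 + Re \<zeta>)\<^sup>2\<close>\<close>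
    show "subharmonic (\<lambda>\<zeta>. u (w0 + \<zeta> *s \<beta>))" by (rule plurisubharmonic_line[OF psh])
    show "(\<lambda>\<zeta>. f (w0 + \<zeta> *s \<beta>)) holomorphic_on UNIV"
      unfolding f_def by (auto intro!: holomorphic_intros)
    show "f (w0 + 0 *s \<beta>) \<noteq> 0" using fw0' by simp
    show "E j holomorphic_on UNIV" for j unfolding E_def by (auto intro!: holomorphic_intros)
    show "deriv (E j) 0 = 0" for j using derE by (rule DERIV_imp_deriv)
    have lin: "continuous_on UNIV (\<lambda>\<zeta>. w0 + \<zeta> *s \<beta>)"
    proof -
      have "continuous_on UNIV (\<lambda>\<zeta>. \<chi> i. w0 $ i + \<zeta> * \<beta> $ i)"
        by (intro continuous_on_vec_lambda continuous_intros)
      moreover have "(\<lambda>\<zeta>. \<chi> i. w0 $ i + \<zeta> * \<beta> $ i) = (\<lambda>\<zeta>. w0 + \<zeta> *s \<beta>)"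
        by (auto simp: fun_eq_iff vec_eq_iff)
      ultimately show ?thesis by (simp only:)
    qed
    have "open {\<zeta>. \<forall>j. norm (poly (F j) ((w0 + \<zeta> *s \<beta>) $ j)) < 2 * exp (l j * T)}"
    proof -
      have "open (\<Inter>j\<in>UNIV. {\<zeta>. norm (poly (F j) ((w0 + \<zeta> *s \<beta>) $ j)) < 2 * exp (l j * T)})"
        by (intro open_INT) (auto intro!: open_Collect_less continuous_intros)
      then show ?thesis by (simp add: INTER_eq)
    qed
    moreover have "open {\<zeta>. \<tau> < norm (f (w0 + \<zeta> *s \<beta>))}"
      by (intro open_Collect_less continuous_intros continuous_on_compose2[OF fcont lin]) auto
    moreover have "open {\<zeta>. 0 < \<sigma>0 + Re \<zeta>}" "open {\<zeta>. \<sigma>0 + Re \<zeta> < T}"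
      by (intro open_Collect_less continuous_intros)+
    ultimately have "open ({\<zeta>. \<forall>j. norm (poly (F j) ((w0 + \<zeta> *s \<beta>) $ j)) < 2 * exp (l j * T)}
       \<inter> {\<zeta>. \<tau> < norm (f (w0 + \<zeta> *s \<beta>))} \<inter> {\<zeta>. 0 < \<sigma>0 + Re \<zeta>} \<inter> {\<zeta>. \<sigma>0 + Re \<zeta> < T})" (is "open ?O")
      by (intro open_Int)
    moreover have "0 \<in> ?O"
    proof -
      have "norm (poly (F j) (w0 $ j)) < 2 * exp (l j * T)" for j
      proof -
        have "exp (l j * \<sigma>0) \<le> exp (l j * T)" using l[of j] \<sigma>0 by simp
        then show ?thesis using qF[of j] by linarith
      qed
      then show ?thesis using fw0 \<sigma>0' by simp
    qed
    ultimately have "eventually (\<lambda>\<zeta>. \<zeta> \<in> ?O) (nhds 0)"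
      by (rule eventually_nhds_in_open)
    then show "\<forall>\<^sub>F \<zeta> in nhds 0. u (w0 + \<zeta> *s \<beta>) +
           ereal (\<delta> * ln (norm (f (w0 + \<zeta> *s \<beta>))) + (2 * \<eta> * \<sigma>0 - \<kappa>) * Re \<zeta> + \<eta> * (Re \<zeta>)\<^sup>2
             - (\<Sum>j\<in>UNIV. (norm (E j \<zeta>))\<^sup>2))
         \<le> ereal (U0 + \<delta> * ln (norm (f (w0 + 0 *s \<beta>))) - (\<Sum>j\<in>UNIV. (norm (E j 0))\<^sup>2))"
    proof eventually_elim
      case (elim \<zeta>)
      then have "w0 + \<zeta> *s \<beta> \<in> B" by (auto simp: B_def less_imp_le)
      with elim have "u (w0 + \<zeta> *s \<beta>) + ereal (r (w0 + \<zeta> *s \<beta>, \<sigma>0 + Re \<zeta>)) \<le> ereal (U0 + r (w0, \<sigma>0))"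
        using max[of "w0 + \<zeta> *s \<beta>" "\<sigma>0 + Re \<zeta>"] by (simp add: U0)
      moreover have "r (w0 + \<zeta> *s \<beta>, \<sigma>0 + Re \<zeta>) =
          (\<delta> * ln (norm (f (w0 + \<zeta> *s \<beta>))) + (2 * \<eta> * \<sigma>0 - \<kappa>) * Re \<zeta> + \<eta> * (Re \<zeta>)\<^sup>2
             - (\<Sum>j\<in>UNIV. (norm (E j \<zeta>))\<^sup>2)) + (- a - \<kappa> * \<sigma>0 + \<eta> * \<sigma>0\<^sup>2)"
      proof -
        have "max \<tau> (norm (f (w0 + \<zeta> *s \<beta>))) = norm (f (w0 + \<zeta> *s \<beta>))" using elim by simp
        then show ?thesis unfolding r_def normE by (simp add: power2_eq_square algebra_simps)
      qed
      moreover have "r (w0, \<sigma>0) =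
          (\<delta> * ln (norm (f (w0 + 0 *s \<beta>))) - (\<Sum>j\<in>UNIV. (norm (E j 0))\<^sup>2)) + (- a - \<kappa> * \<sigma>0 + \<eta> * \<sigma>0\<^sup>2)"
      proof -
        have "max \<tau> (norm (f w0)) = norm (f w0)" using fw0 by simp
        then show ?thesis unfolding r_def normE by (simp add: power2_eq_square algebra_simps)
      qed
      ultimately show ?case by (cases "u (w0 + \<zeta> *s \<beta>)") auto
    qed
  qed (use \<eta> in auto)
  then show False using U0 by simp
qed

text \<open>
  Critical points of the \<open>F j\<close> are isolated in each variable, so a small circle around \<open>z\<close> in the
  diagonal direction meets none of them, and the sub-mean value inequality carries the bound from
  this circle to \<open>z\<close>.
\<close>

lemma hadamard_lemniscate:
  fixes u :: "complex ^ 'n::finite \<Rightarrow> ereal" and F :: "'n \<Rightarrow> complex poly"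
  assumes psh: "plurisubharmonic u"
    and deg: "\<And>j. degree (F j) > 0" and l: "\<And>j. l j > 0" and s: "0 < s" "s < T"
    and a: "\<And>w. (\<And>j. norm (poly (F j) (w $ j)) \<le> 2) \<Longrightarrow> u w \<le> ereal a"
    and b: "\<And>w. (\<And>j. norm (poly (F j) (w $ j)) \<le> 2 * exp (l j * T)) \<Longrightarrow> u w \<le> ereal b"
    and z: "\<And>j. norm (poly (F j) (z $ j)) < exp (l j * s)"
  shows "u z \<le> ereal (a + (b - a) / T * s)"
proof -
  let ?e = "(\<chi> j. 1) :: complex ^ 'n"
  have nz: "pderiv (F j) \<noteq> 0" for j
    using deg[of j] by (simp add: pderiv_eq_0_iff)
  have ev1: "eventually (\<lambda>\<zeta>. poly (pderiv (F j)) ((z + \<zeta> *s ?e) $ j) \<noteq> 0) (at 0)" for j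
  proof -
    have "finite {x. poly (pderiv (F j)) x = 0}" by (rule poly_roots_finite[OF nz])
    then have "finite ((\<lambda>x. x - z $ j) ` {x. poly (pderiv (F j)) x = 0})" by simp
    then have "eventually (\<lambda>\<zeta>. \<zeta> \<notin> (\<lambda>x. x - z $ j) ` {x. poly (pderiv (F j)) x = 0}) (at 0)"
      using islimpt_finite by (simp add: islimpt_iff_eventually)
    then show ?thesis
      by eventually_elim (force simp: image_iff algebra_simps)
  qed
  have ev2: "eventually (\<lambda>\<zeta>. norm (poly (F j) ((z + \<zeta> *s ?e) $ j)) < exp (l j * s)) (at 0)" for j
  proof -
    have "open {\<zeta>. norm (poly (F j) ((z + \<zeta> *s ?e) $ j)) < exp (l j * s)}" (is "open ?O")
      by (auto intro!: open_Collect_less continuous_intros)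
    then have "eventually (\<lambda>\<zeta>. \<zeta> \<in> ?O) (nhds 0)"
      by (rule eventually_nhds_in_open) (use z in simp)
    then show ?thesis by (simp add: eventually_at_filter eventually_mono)
  qed
  have "eventually (\<lambda>\<zeta>. \<forall>j. poly (pderiv (F j)) ((z + \<zeta> *s ?e) $ j) \<noteq> 0
       \<and> norm (poly (F j) ((z + \<zeta> *s ?e) $ j)) < exp (l j * s)) (at 0)"
    by (intro eventually_all_finite eventually_conj ev1 ev2)
  then obtain d where d: "d > 0" and near: "\<And>\<zeta> j. \<zeta> \<noteq> 0 \<Longrightarrow> dist \<zeta> 0 < d \<Longrightarrow>
       poly (pderiv (F j)) ((z + \<zeta> *s ?e) $ j) \<noteq> 0 \<and> norm (poly (F j) ((z + \<zeta> *s ?e) $ j)) < exp (l j * s)"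
    unfolding eventually_at by blast
  have "u (z + 0 *s ?e) \<le> ereal (Re (of_real (a + (b - a) / T * s)))"
  proof (rule subharmonic_le_Re_holomorphic[OF plurisubharmonic_line[OF psh], where r = "d / 2"])
    fix \<zeta> :: complex assume "dist 0 \<zeta> = d / 2"
    then have "\<zeta> \<noteq> 0" "dist \<zeta> 0 < d" using d by (auto simp: dist_norm)
    from near[OF this] have "u (z + \<zeta> *s ?e) \<le> ereal (a + (b - a) / T * s)"
      by (intro hadamard_noncritical[OF psh deg l s a b]) auto
    then show "u (z + \<zeta> *s ?e) \<le> ereal (Re (of_real (a + (b - a) / T * s)))" by simp
  qed (use d in auto)
  then show ?thesis by simp
qed

section \<open>Polynomial hulls\<close>

definition poly_hull :: "complex set \<Rightarrow> complex set" where
  "poly_hull K = {z. \<forall>p c. (\<forall>w\<in>K. norm (poly p w) \<le> c) \<longrightarrow> norm (poly p z) \<le> c}"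

lemma poly_hullD:
  assumes "z \<in> poly_hull K" "\<And>w. w \<in> K \<Longrightarrow> norm (poly p w) \<le> c"
  shows "norm (poly p z) \<le> c"
  using assms by (auto simp: poly_hull_def)

lemma subset_poly_hull: "K \<subseteq> poly_hull K"
  by (auto simp: poly_hull_def)

lemma compact_poly_hull:
  assumes "compact K"
  shows "compact (poly_hull K)"
proof -
  have "poly_hull K = (\<Inter>(p,c)\<in>{(p,c). \<forall>w\<in>K. norm (poly p w) \<le> c}. {z. norm (poly p z) \<le> c})"
    by (auto simp: poly_hull_def)
  also have "closed \<dots>"
    by (intro closed_INT) (auto intro!: closed_Collect_le continuous_intros)
  finally have "closed (poly_hull K)" .
  moreover obtain R where "\<And>w. w \<in> K \<Longrightarrow> norm w \<le> R"
    using compact_imp_bounded[OF assms] unfolding bounded_iff by blast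
  then have "norm z \<le> R" if "z \<in> poly_hull K" for z
    using poly_hullD[OF that, of "[:0, 1:]" R] by simp
  then have "bounded (poly_hull K)" unfolding bounded_iff by blast
  ultimately show ?thesis by (simp add: compact_eq_bounded_closed)
qed

text \<open>
  The points that the hull adds to \<open>K\<close> fill bounded components of the complement; what matters is
  that they form an open set. Let \<open>b\<close> be such a point and \<open>b'\<close> outside the hull, so that some polynomial
  \<open>P\<close> has \<open>P b' = 1\<close> and \<open>\<bar>P\<bar> \<le> \<theta> < 1\<close> on \<open>K\<close>. The polynomial \<open>(1 - P ^ k) / (w - b')\<close> has modulus about
  \<open>1 / dist w b'\<close> on \<open>K\<close> and about \<open>1 / dist b b'\<close> at \<open>b\<close>. As \<open>b\<close> is in the hull, \<open>b'\<close> is at least as far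
  from \<open>b\<close> as from \<open>K\<close>, which excludes \<open>b'\<close> from a neighbourhood of \<open>b\<close>.
\<close>

lemma open_poly_hull_diff:
  assumes "compact K"
  shows "open (poly_hull K - K)"
  unfolding open_dist
proof (intro ballI)
  fix b assume b: "b \<in> poly_hull K - K"
  have "open (- K)" using assms by (simp add: compact_imp_closed open_Compl)
  then obtain e where e: "e > 0" "\<And>w. dist w b < e \<Longrightarrow> w \<notin> K"
    using b unfolding open_dist by auto
  have ne: "K \<noteq> {}"
  proof
    assume "K = {}"
    then have "norm (poly 0 b) \<le> (-1 :: real)" using poly_hullD[of b K 0 "-1"] b by simp
    then show False by simp
  qed
  have "b' \<in> poly_hull K - K" if b': "dist b' b < e / 2" for b'
  proof -
    have "b' \<in> poly_hull K"
    proof (rule ccontr)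
      assume "b' \<notin> poly_hull K"
      then obtain p c where pc: "\<And>w. w \<in> K \<Longrightarrow> norm (poly p w) \<le> c" "\<not> norm (poly p b') \<le> c"
        by (auto simp: poly_hull_def)
      have c0: "c \<ge> 0" using ne pc(1) norm_ge_zero order_trans by blast
      have pb': "poly p b' \<noteq> 0" using pc(2) c0 by auto
      define P where "P = smult (1 / poly p b') p"
      define \<theta> where "\<theta> = c / norm (poly p b')"
      have \<theta>: "0 \<le> \<theta>" "\<theta> < 1" using pc(2) c0 pb' by (auto simp: \<theta>_def field_simps)
      have PK: "norm (poly P w) \<le> \<theta>" if "w \<in> K" for w
        using pc(1)[OF that] by (simp add: P_def \<theta>_def norm_divide divide_right_mono)
      have Pb: "norm (poly P b) \<le> \<theta>" using b PK by (intro poly_hullD[of b K]) auto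
      define m where "m = e - dist b' b"
      have m: "m > dist b' b" "m > 0" using b' e(1) zero_le_dist[of b' b] unfolding m_def by linarith+
      have ineq: "1 - \<theta> ^ k \<le> (1 + \<theta> ^ k) * (dist b' b / m)" for k
      proof -
        have "poly (1 - P ^ k) b' = 0" using pb' by (simp add: P_def)
        then obtain R where R: "1 - P ^ k = [:- b', 1:] * R"
          unfolding poly_eq_0_iff_dvd dvd_def by blast
        have Rx: "norm (poly R x) * dist x b' = norm (1 - poly P x ^ k)" for x
        proof -
          have "poly (1 - P ^ k) x = (x - b') * poly R x" unfolding R by (simp add: algebra_simps)
          moreover have "poly (1 - P ^ k) x = 1 - poly P x ^ k" by simp
          ultimately have "1 - poly P x ^ k = (x - b') * poly R x" by metis
          then show ?thesis by (simp only: norm_mult dist_norm mult.commute)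
        qed
        have RK: "norm (poly R w) \<le> (1 + \<theta> ^ k) / m" if w: "w \<in> K" for w
        proof -
          have "\<not> dist w b < e" using e(2) w by blast
          then have mw: "m \<le> dist w b'"
            using dist_triangle[of w b b'] unfolding m_def by linarith
          have "norm (1 - poly P w ^ k) \<le> 1 + norm (poly P w) ^ k"
            using norm_triangle_ineq4[of 1 "poly P w ^ k"] by (simp add: norm_power)
          also have "\<dots> \<le> 1 + \<theta> ^ k" using PK[OF w] by (simp add: power_mono)
          finally have "norm (poly R w) * dist w b' \<le> 1 + \<theta> ^ k" unfolding Rx .
          moreover have "norm (poly R w) * m \<le> norm (poly R w) * dist w b'"
            using mw by (intro mult_left_mono) auto
          ultimately show ?thesis using m by (simp add: field_simps)
        qed
        have "norm (poly R b) \<le> (1 + \<theta> ^ k) / m" using b RK by (intro poly_hullD[of b K]) auto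
        then have "norm (poly R b) * dist b b' \<le> (1 + \<theta> ^ k) / m * dist b b'"
          by (intro mult_right_mono) auto
        moreover have "1 - \<theta> ^ k \<le> norm (1 - poly P b ^ k)"
        proof -
          have "norm (poly P b ^ k) \<le> \<theta> ^ k" using Pb by (simp add: norm_power power_mono)
          then show ?thesis using norm_triangle_ineq2[of 1 "poly P b ^ k"] by simp
        qed
        ultimately show ?thesis unfolding Rx by (simp add: dist_commute)
      qed
      have lim: "(\<lambda>k. \<theta> ^ k) \<longlonglongrightarrow> 0" using \<theta> by (intro LIMSEQ_power_zero) auto
      have "(\<lambda>k. 1 - \<theta> ^ k) \<longlonglongrightarrow> 1 - 0" by (intro tendsto_intros lim)
      moreover have "(\<lambda>k. (1 + \<theta> ^ k) * (dist b' b / m)) \<longlonglongrightarrow> (1 + 0) * (dist b' b / m)"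
        by (intro tendsto_intros lim)
      ultimately have "1 - 0 \<le> (1 + 0) * (dist b' b / m)"
        by (rule LIMSEQ_le) (use ineq in blast)
      then show False using m by (simp add: field_simps)
    qed
    moreover have "b' \<notin> K" using e b' by (metis dual_order.strict_trans field_sum_of_halves less_add_same_cancel1 half_gt_zero)
    ultimately show ?thesis by blast
  qed
  then show "\<exists>e>0. \<forall>y. dist y b < e \<longrightarrow> y \<in> poly_hull K - K"
    using e(1) by (intro exI[of _ "e / 2"]) auto
qed

text \<open>
  Add a small multiple of the squared Euclidean norm and maximise over the product of the hulls.
  A maximum with a coordinate in \<open>poly_hull (K j) - K j\<close> could be improved by moving this coordinate
  alone, since the hull contains a small circle around it.
\<close>

lemma plurisubharmonic_le_on_poly_hull:
  fixes u :: "complex ^ 'n::finite \<Rightarrow> ereal"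
  assumes psh: "plurisubharmonic u" and K: "\<And>j. compact (K j)"
    and le: "\<And>w :: complex ^ 'n. (\<And>j. w $ j \<in> K j) \<Longrightarrow> u w \<le> 0"
    and z: "\<And>j. z $ j \<in> poly_hull (K j)"
  shows "u z \<le> 0"
proof (rule ccontr)
  assume neg: "\<not> ?thesis"
  define X where "X = {w :: complex ^ 'n. \<forall>j. w $ j \<in> poly_hull (K j)}"
  have X: "compact X" unfolding X_def by (intro compact_vec_product compact_poly_hull K)
  have zX: "z \<in> X" using z by (simp add: X_def)
  define Q where "Q = (\<lambda>w :: complex ^ 'n. \<Sum>j\<in>UNIV. (norm (w $ j))\<^sup>2)"
  have Qcont: "continuous_on UNIV Q" unfolding Q_def by (intro continuous_intros)
  have "bounded (Q ` X)"
    by (intro compact_imp_bounded compact_continuous_image continuous_on_subset[OF Qcont] X) auto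
  then obtain C where "\<And>w. w \<in> X \<Longrightarrow> norm (Q w) \<le> C" unfolding bounded_iff by blast
  then have C: "\<And>w. w \<in> X \<Longrightarrow> Q w \<le> C" by force
  have Q0: "Q w \<ge> 0" for w unfolding Q_def by (intro sum_nonneg) auto
  have C0: "C \<ge> 0" using C[OF zX] Q0[of z] by linarith
  obtain a where a: "0 < a" "ereal a < u z" using neg ereal_dense2[of 0 "u z"] by (auto simp: not_le)
  define \<epsilon> where "\<epsilon> = a / (C + 1)"
  have \<epsilon>: "\<epsilon> > 0" "\<epsilon> * C < a" using a C0 by (auto simp: \<epsilon>_def field_simps)
  have "\<exists>x\<in>X. \<forall>y\<in>X. u y + ereal (\<epsilon> * Q y) \<le> u x + ereal (\<epsilon> * Q x)"
  proof (rule usc_attains_sup[OF _ X])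
    show "usc (\<lambda>y. u y + ereal (\<epsilon> * Q y))"
      by (intro usc_add_continuous continuous_intros Qcont plurisubharmonic_usc[OF psh]
          plurisubharmonic_less_infinity[OF psh])
  qed (use zX in auto)
  then obtain x where x: "x \<in> X" and max: "\<And>y. y \<in> X \<Longrightarrow> u y + ereal (\<epsilon> * Q y) \<le> u x + ereal (\<epsilon> * Q x)"
    by blast
  have "ereal a \<le> u z + ereal (\<epsilon> * Q z)"
    using a Q0[of z] \<epsilon> by (cases "u z") (auto intro: add_increasing2)
  also have "\<dots> \<le> u x + ereal (\<epsilon> * Q x)" by (rule max[OF zX])
  finally have ax: "ereal a \<le> u x + ereal (\<epsilon> * Q x)" .
  moreover have "u x \<noteq> \<infinity>" using plurisubharmonic_less_infinity[OF psh, of x] by auto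
  ultimately obtain U where U: "u x = ereal U" by (cases "u x") auto
  have "\<epsilon> * Q x \<le> \<epsilon> * C" using C[OF x] \<epsilon> by (intro mult_left_mono) auto
  then have Upos: "U > 0" using ax \<epsilon>(2) unfolding U by simp
  have "\<exists>j. x $ j \<notin> K j"
  proof (rule ccontr)
    assume "\<not> ?thesis"
    then have "u x \<le> 0" by (intro le) auto
    then show False using Upos by (simp add: U)
  qed
  then obtain j where "x $ j \<in> poly_hull (K j) - K j" using x by (auto simp: X_def)
  then obtain d where d: "d > 0" "\<And>y. dist y (x $ j) < d \<Longrightarrow> y \<in> poly_hull (K j)"
    using open_poly_hull_diff[OF K[of j]] unfolding open_dist by blast
  define r where "r = d / 2"
  have r: "r > 0" "r < d" using d by (auto simp: r_def)
  let ?e = "axis j 1 :: complex ^ 'n"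
  have comp: "(x + \<zeta> *s ?e) $ i = (if i = j then x $ j + \<zeta> else x $ i)" for \<zeta> i
    by (auto simp: axis_def)
  have "u (x + 0 *s ?e) \<le> ereal (Re (of_real (U - \<epsilon> * r\<^sup>2) - 2 * of_real \<epsilon> * cnj (x $ j) * 0))"
  proof (rule subharmonic_le_Re_holomorphic[OF plurisubharmonic_line[OF psh] r(1)])
    fix \<zeta> :: complex assume "dist 0 \<zeta> = r"
    then have nz: "norm \<zeta> = r" by (simp add: dist_norm)
    have "x + \<zeta> *s ?e \<in> X"
    proof -
      have "(x + \<zeta> *s ?e) $ i \<in> poly_hull (K i)" for i
        unfolding comp using x d(2)[of "x $ j + \<zeta>"] nz r by (auto simp: X_def dist_norm)
      then show ?thesis unfolding X_def by blast
    qed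
    from max[OF this] have "u (x + \<zeta> *s ?e) \<le> ereal (U + \<epsilon> * (Q x - Q (x + \<zeta> *s ?e)))"
      by (cases "u (x + \<zeta> *s ?e)") (auto simp: U algebra_simps)
    also have "Q x - Q (x + \<zeta> *s ?e) = (norm (x $ j))\<^sup>2 - (norm (x $ j + \<zeta>))\<^sup>2"
    proof -
      have "Q x = (norm (x $ j))\<^sup>2 + (\<Sum>i\<in>UNIV - {j}. (norm (x $ i))\<^sup>2)"
        unfolding Q_def by (rule sum.remove) auto
      moreover have "Q (x + \<zeta> *s ?e) = (norm (x $ j + \<zeta>))\<^sup>2 + (\<Sum>i\<in>UNIV - {j}. (norm (x $ i))\<^sup>2)"
        unfolding Q_def comp by (subst sum.remove[of _ j]) auto
      ultimately show ?thesis by simp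
    qed
    also have "\<dots> = - (2 * Re (cnj (x $ j) * \<zeta>) + r\<^sup>2)"
      unfolding nz[symmetric] cmod_power2 by (simp add: power2_eq_square algebra_simps)
    finally show "u (x + \<zeta> *s ?e) \<le> ereal (Re (of_real (U - \<epsilon> * r\<^sup>2) - 2 * of_real \<epsilon> * cnj (x $ j) * \<zeta>))"
      by (simp add: algebra_simps)
  qed (auto intro!: holomorphic_intros)
  then have "\<epsilon> * r\<^sup>2 \<le> 0" using U by simp
  moreover have "\<epsilon> * r\<^sup>2 > 0" using \<epsilon>(1) r(1) by simp
  ultimately show False by simp
qed

section \<open>Fekete points and lemniscates\<close>

text \<open>The squared modulus of the Vandermonde determinant of the first \<open>d\<close> points.\<close>

definition fekete_product :: "nat \<Rightarrow> (nat \<Rightarrow> complex) \<Rightarrow> real" where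
  "fekete_product d t = (\<Prod>i<d. \<Prod>j\<in>{..<d} - {i}. dist (t i) (t j))"

text \<open>
  Every pair of distinct indices is counted in both orders, which is why the factor that depends
  on the point \<open>t i\<close> appears as a square.
\<close>

lemma fekete_product_split:
  assumes i: "i < d"
  shows "fekete_product d t = (\<Prod>j\<in>{..<d} - {i}. dist (t i) (t j))\<^sup>2 *
     (\<Prod>a\<in>{..<d} - {i}. \<Prod>j\<in>{..<d} - {a} - {i}. dist (t a) (t j))"
proof -
  have "fekete_product d t = (\<Prod>j\<in>{..<d} - {i}. dist (t i) (t j)) *
     (\<Prod>a\<in>{..<d} - {i}. \<Prod>j\<in>{..<d} - {a}. dist (t a) (t j))"
    unfolding fekete_product_def using i by (subst prod.remove[of _ i]) auto
  also have "(\<Prod>a\<in>{..<d} - {i}. \<Prod>j\<in>{..<d} - {a}. dist (t a) (t j)) =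
     (\<Prod>a\<in>{..<d} - {i}. dist (t a) (t i) * (\<Prod>j\<in>{..<d} - {a} - {i}. dist (t a) (t j)))"
    using i by (intro prod.cong refl prod.remove) auto
  also have "\<dots> = (\<Prod>a\<in>{..<d} - {i}. dist (t i) (t a)) *
     (\<Prod>a\<in>{..<d} - {i}. \<Prod>j\<in>{..<d} - {a} - {i}. dist (t a) (t j))"
    unfolding prod.distrib by (simp add: dist_commute)
  finally show ?thesis by (simp add: power2_eq_square mult.assoc)
qed

text \<open>
  Points of \<open>K\<close> with maximal product of mutual distances: replacing one of them by another point
  of \<open>K\<close> cannot increase the product. The maximum exists by compactness of the product space
  \<open>nat \<Rightarrow> K\<close>, and it is positive because \<open>K\<close> is infinite.
\<close>

lemma fekete_points_exist:
  fixes K :: "complex set" and d :: nat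
  assumes K: "compact K" "infinite K"
  obtains t where "\<And>i. t i \<in> K" "inj_on t {..<d}"
    "\<And>i z. i < d \<Longrightarrow> z \<in> K \<Longrightarrow>
       (\<Prod>j\<in>{..<d} - {i}. dist z (t j)) \<le> (\<Prod>j\<in>{..<d} - {i}. dist (t i) (t j))"
proof -
  define P where "P = (PiE UNIV (\<lambda>i :: nat. K))"
  have "compactin (product_topology (\<lambda>i :: nat. euclidean) UNIV) P"
    unfolding P_def using K by (simp add: compactin_PiE)
  then have P: "compact P" by (simp add: euclidean_product_topology)
  obtain f :: "nat \<Rightarrow> complex" where f: "inj f" "range f \<subseteq> K"
    using infinite_countable_subset[OF K(2)] by blast
  have fP: "f \<in> P" using f by (auto simp: P_def)
  have coord: "continuous_on P (\<lambda>s. s i)" for i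
    by (rule continuous_on_subset[OF continuous_on_product_coordinates]) simp
  have "continuous_on P (fekete_product d)"
    unfolding fekete_product_def by (intro continuous_on_prod continuous_on_dist coord)
  then obtain t where t: "t \<in> P" and max: "\<And>s. s \<in> P \<Longrightarrow> fekete_product d s \<le> fekete_product d t"
    using continuous_attains_sup[OF P, of "fekete_product d"] fP by blast
  have "fekete_product d f > 0"
    unfolding fekete_product_def using f(1) by (intro prod_pos) (auto dest: injD)
  then have pos: "fekete_product d t > 0" using max[OF fP] by linarith
  have "inj_on t {..<d}"
  proof (rule inj_onI, rule ccontr)
    fix i j assume ij: "i \<in> {..<d}" "j \<in> {..<d}" "t i = t j" "i \<noteq> j"
    then have "(\<Prod>j\<in>{..<d} - {i}. dist (t i) (t j)) = 0" by (intro prod_zero) auto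
    then have "fekete_product d t = 0" unfolding fekete_product_def using ij by (intro prod_zero) auto
    then show False using pos by simp
  qed
  moreover have "(\<Prod>j\<in>{..<d} - {i}. dist z (t j)) \<le> (\<Prod>j\<in>{..<d} - {i}. dist (t i) (t j))"
    if i: "i < d" and z: "z \<in> K" for i z
  proof -
    define t' where "t' = t(i := z)"
    define R where "R = (\<Prod>a\<in>{..<d} - {i}. \<Prod>j\<in>{..<d} - {a} - {i}. dist (t a) (t j))"
    have "t' \<in> P" using t z by (auto simp: P_def t'_def)
    have "fekete_product d t' = (\<Prod>j\<in>{..<d} - {i}. dist z (t j))\<^sup>2 * R"
    proof -
      have "(\<Prod>a\<in>{..<d} - {i}. \<Prod>j\<in>{..<d} - {a} - {i}. dist (t' a) (t' j)) = R"
        unfolding R_def t'_def by (intro prod.cong) auto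
      moreover have "(\<Prod>j\<in>{..<d} - {i}. dist (t' i) (t' j)) = (\<Prod>j\<in>{..<d} - {i}. dist z (t j))"
        unfolding t'_def by (intro prod.cong) auto
      ultimately show ?thesis unfolding fekete_product_split[OF i] by simp
    qed
    moreover have t_eq: "fekete_product d t = (\<Prod>j\<in>{..<d} - {i}. dist (t i) (t j))\<^sup>2 * R"
      unfolding R_def by (rule fekete_product_split[OF i])
    moreover have "R > 0"
    proof -
      have "R \<ge> 0" unfolding R_def by (intro prod_nonneg) (auto intro: prod_nonneg)
      moreover have "R \<noteq> 0" using pos t_eq by auto
      ultimately show ?thesis by simp
    qed
    ultimately have "(\<Prod>j\<in>{..<d} - {i}. dist z (t j))\<^sup>2 \<le> (\<Prod>j\<in>{..<d} - {i}. dist (t i) (t j))\<^sup>2"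
      using max[OF \<open>t' \<in> P\<close>] by simp
    then show ?thesis by (rule power2_le_imp_le) (auto intro: prod_nonneg)
  qed
  moreover have "t i \<in> K" for i using t by (auto simp: P_def)
  ultimately show ?thesis using that by blast
qed

lemma lagrange_interpolation:
  fixes t :: "nat \<Rightarrow> complex"
  assumes inj: "inj_on t {..<d}" and Q: "degree Q < d"
  shows "poly Q z = (\<Sum>i<d. poly Q (t i) * (\<Prod>j\<in>{..<d} - {i}. (z - t j) / (t i - t j)))"
proof -
  define L where "L i = (\<Prod>j\<in>{..<d} - {i}. smult (1 / (t i - t j)) [:- t j, 1:])" for i
  have pL: "poly (L i) z = (\<Prod>j\<in>{..<d} - {i}. (z - t j) / (t i - t j))" for i z
    by (simp add: L_def poly_prod diff_divide_distrib)
  define R where "R = (\<Sum>i<d. smult (poly Q (t i)) (L i))"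
  have pR: "poly R z = (\<Sum>i<d. poly Q (t i) * (\<Prod>j\<in>{..<d} - {i}. (z - t j) / (t i - t j)))" for z
    by (simp add: R_def poly_sum pL)
  have card: "card (t ` {..<d}) = d" using inj by (simp add: card_image)
  have degL: "degree (L i) < d" if "i < d" for i
  proof -
    have "degree (L i) \<le> (\<Sum>j\<in>{..<d} - {i}. degree (smult (1 / (t i - t j)) [:- t j, 1:]))"
      unfolding L_def using degree_prod_sum_le[of "{..<d} - {i}" "\<lambda>j. smult (1 / (t i - t j)) [:- t j, 1:]"]
      by (simp add: o_def)
    also have "\<dots> \<le> (\<Sum>j\<in>{..<d} - {i}. 1)"
      by (intro sum_mono) (auto intro: order_trans[OF degree_smult_le])
    also have "\<dots> < d" using that by simp
    finally show ?thesis .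
  qed
  have degR: "degree R < d"
    unfolding R_def using degL Q
    by (intro degree_sum_less le_less_trans[OF degree_smult_le]) auto
  have "Q = R"
  proof (rule poly_eqI_degree[where A = "t ` {..<d}"])
    fix x assume "x \<in> t ` {..<d}"
    then obtain k where k: "k < d" "x = t k" by auto
    have "poly (L i) (t k) = (if i = k then 1 else 0)" if "i < d" for i
    proof (cases "i = k")
      case True
      have "t k - t j \<noteq> 0" if "j \<in> {..<d} - {k}" for j
        using inj that k by (auto dest: inj_onD)
      then show ?thesis unfolding pL True by (auto intro!: prod.neutral)
    next
      case False
      then show ?thesis unfolding pL using k by (auto intro!: prod_zero bexI[of _ k])
    qed
    then have "poly R x = (\<Sum>i<d. poly Q (t i) * (if i = k then 1 else 0))"
      unfolding R_def k(2) poly_sum poly_smult by (intro sum.cong) auto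
    also have "\<dots> = poly Q (t k)" using k by (simp add: sum.delta' if_distrib cong: if_cong)
    finally show "poly Q x = poly R x" using k by simp
  qed (use card Q degR in auto)
  then show ?thesis by (metis pR)
qed

text \<open>
  Each point off the hull is separated from \<open>K\<close> by some polynomial, and a high power makes the
  separation as large as \<open>2\<close>. Compactness handles a large disc, and a multiple of the identity
  handles its exterior.
\<close>

lemma polynomials_separating_from_poly_hull:
  assumes K: "compact K" "K \<noteq> {}" and U: "open U" "poly_hull K \<subseteq> U"
  obtains \<P> where "finite \<P>" "\<And>p w. p \<in> \<P> \<Longrightarrow> w \<in> K \<Longrightarrow> norm (poly p w) \<le> 1"
    "\<And>z. z \<notin> U \<Longrightarrow> \<exists>p\<in>\<P>. norm (poly p z) > 2"
proof -
  define S where "S = {p :: complex poly. \<forall>w\<in>K. norm (poly p w) \<le> 1}"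
  obtain R' where R': "\<And>w. w \<in> K \<Longrightarrow> norm w \<le> R'"
    using compact_imp_bounded[OF K(1)] unfolding bounded_iff by blast
  define R where "R = max R' 1"
  have R: "R > 0" "\<And>w. w \<in> K \<Longrightarrow> norm w \<le> R" using R' by (force simp: R_def)+
  define p0 where "p0 = [:0, of_real (1 / R) :: complex:]"
  have p0: "norm (poly p0 z) = norm z / R" for z
    using R(1) by (simp add: p0_def norm_mult norm_divide)
  have p0S: "p0 \<in> S" using R by (auto simp: S_def p0)
  have far: "\<exists>p\<in>S. norm (poly p z) > 2" if z: "z \<notin> U" for z
  proof -
    have "z \<notin> poly_hull K" using z U by blast
    then obtain p c where pc: "\<And>w. w \<in> K \<Longrightarrow> norm (poly p w) \<le> c" "c < norm (poly p z)"
      by (auto simp: poly_hull_def not_le)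
    have "c \<ge> 0" using K(2) pc(1) norm_ge_zero order_trans by blast
    obtain c' where "c < c'" "c' < norm (poly p z)" using dense[OF pc(2)] by blast
    with \<open>c \<ge> 0\<close> have c': "0 < c'" "c < c'" "c' < norm (poly p z)" by auto
    obtain k where k: "2 < (norm (poly p z) / c') ^ k"
      using real_arch_pow[of "norm (poly p z) / c'" 2] c' by (auto simp: field_simps)
    have "norm (poly (smult (of_real (1 / c')) p ^ k) w) \<le> 1" if "w \<in> K" for w
    proof -
      have "norm (poly p w) / c' \<le> 1" using pc(1)[OF that] c' by simp
      then show ?thesis using c' by (simp add: norm_power norm_mult norm_divide power_le_one)
    qed
    moreover have "norm (poly (smult (of_real (1 / c')) p ^ k) z) > 2"
      using k c' by (simp add: norm_power norm_mult norm_divide)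
    ultimately show ?thesis
      unfolding S_def by (intro bexI[of _ "smult (of_real (1 / c')) p ^ k"] CollectI ballI)
  qed
  have "compact (cball 0 (2 * R) - U)" using U by (intro compact_diff) auto
  moreover have "cball 0 (2 * R) - U \<subseteq> (\<Union>p\<in>S. {z. 2 < norm (poly p z)})" using far by blast
  moreover have "open {z. 2 < norm (poly p z)}" for p :: "complex poly"
    by (intro open_Collect_less continuous_intros)
  ultimately obtain D where D: "D \<subseteq> S" "finite D" "cball 0 (2 * R) - U \<subseteq> (\<Union>p\<in>D. {z. 2 < norm (poly p z)})"
    using compactE_image[of "cball 0 (2 * R) - U" S "\<lambda>p. {z. 2 < norm (poly p z)}"] by metis
  show ?thesis
  proof (rule that[of "insert p0 D"])
    fix z assume z: "z \<notin> U"
    show "\<exists>p\<in>insert p0 D. norm (poly p z) > 2"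
    proof (cases "norm z \<le> 2 * R")
      case True
      then have "z \<in> cball 0 (2 * R) - U" using z by simp
      then show ?thesis using D(3) by blast
    next
      case False
      then show ?thesis using R(1) by (simp add: p0 field_simps)
    qed
  qed (use D p0S in \<open>auto simp: S_def\<close>)
qed

lemma exponential_beats_linear: "\<exists>k. c * real (k * D + 1) < 2 ^ k"
proof -
  have "(\<lambda>k. c * (real D * (real k * (1/2) ^ k) + (1/2) ^ k)) \<longlonglongrightarrow> c * (real D * 0 + 0)"
    using powser_times_n_limit_0[of "1/2 :: real"]
    by (intro tendsto_intros LIMSEQ_power_zero) auto
  then have "eventually (\<lambda>k. c * (real D * (real k * (1/2) ^ k) + (1/2) ^ k) < 1) sequentially"
    by (intro order_tendstoD(2)) auto
  then obtain k where "c * (real D * (real k * (1/2) ^ k) + (1/2) ^ k) < 1"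
    unfolding eventually_sequentially by blast
  then have "c * (real D * (real k * (1/2) ^ k) + (1/2) ^ k) * 2 ^ k < 1 * 2 ^ k"
    by (intro mult_strict_right_mono) auto
  moreover have "(1/2 :: real) ^ k * 2 ^ k = 1"
    by (simp flip: power_mult_distrib)
  then have "c * (real D * (real k * (1/2) ^ k) + (1/2) ^ k) * 2 ^ k = c * real (k * D + 1)"
    by (simp add: algebra_simps)
  ultimately show ?thesis by (intro exI[of _ k]) simp
qed

text \<open>
  For infinite \<open>K\<close> the polynomial with zeros at \<open>d\<close> Fekete points \<open>t i\<close> of \<open>K\<close> works, suitably scaled.
  Let \<open>N i\<close> be the product of the distances from \<open>t i\<close> to the other points. On \<open>K\<close> the monic polynomial
  is bounded by \<open>m * N i\<close> for every \<open>i\<close>, where \<open>m\<close> exceeds the diameter, by the Fekete property. Off \<open>U\<close>, take a polynomial of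
  degree less than \<open>d\<close> that is bounded by \<open>1\<close> on \<open>K\<close> and exponentially large at \<open>z\<close>, and
  interpolate it at the \<open>t i\<close>: one of the \<open>d\<close> Lagrange polynomials must be large at \<open>z\<close>, and up to the
  factor \<open>dist z (t i)\<close>, bounded below, it is the monic polynomial divided by \<open>N i\<close>.
  The exponential gain beats \<open>d\<close>. For finite \<open>K\<close> the zeros can be put at the points of \<open>K\<close>.
\<close>

theorem hilbert_lemniscate:
  assumes K: "compact K" "K \<noteq> {}" and U: "open U" "poly_hull K \<subseteq> U"
  obtains F :: "complex poly" where "degree F > 0" "\<And>z. z \<in> K \<Longrightarrow> norm (poly F z) \<le> 1"
    "\<And>z. norm (poly F z) \<le> 2 \<Longrightarrow> z \<in> U"
proof -
  have KU: "K \<subseteq> U" using subset_poly_hull U by blast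
  obtain \<delta> where \<delta>: "\<delta> > 0" "\<And>t z. t \<in> K \<Longrightarrow> z \<notin> U \<Longrightarrow> \<delta> \<le> dist z t"
  proof -
    have "\<exists>d>0. \<forall>x\<in>K. \<forall>y\<in>- U. d \<le> dist x y"
      using K U KU by (intro separate_compact_closed) auto
    then obtain d where "d > 0" "\<forall>x\<in>K. \<forall>y\<in>- U. d \<le> dist x y" by blast
    then show ?thesis using that[of d] by (auto simp: dist_commute)
  qed
  show ?thesis
  proof (cases "finite K")
    case fin: True
    define c where "c = 3 / \<delta> ^ card K"
    have c: "c > 0" using \<delta> by (simp add: c_def)
    define F where "F = smult (of_real c) (\<Prod>t\<in>K. [:- t, 1:])"
    have "degree F = card K"
      using c by (simp add: F_def degree_prod_sum_eq)
    moreover have "card K > 0" using fin K by (simp add: card_gt_0_iff)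
    moreover have "norm (poly F z) \<le> 1" if "z \<in> K" for z
    proof -
      have "(\<Prod>t\<in>K. z - t) = 0" using fin that by (intro prod_zero) auto
      then show ?thesis by (simp add: F_def poly_prod)
    qed
    moreover have "z \<in> U" if "norm (poly F z) \<le> 2" for z
    proof (rule ccontr)
      assume z: "z \<notin> U"
      have "\<delta> ^ card K = (\<Prod>t\<in>K. \<delta>)" by simp
      also have "\<dots> \<le> (\<Prod>t\<in>K. norm (z - t))"
        using \<delta> z by (intro prod_mono) (auto simp: dist_norm)
      finally have "c * \<delta> ^ card K \<le> norm (poly F z)"
        using c by (simp add: F_def poly_prod norm_mult prod_norm)
      then show False using that \<delta> by (simp add: c_def)
    qed
    ultimately show ?thesis using that[of F] by metis
  next
    case inf: False
    obtain \<P> where \<P>: "finite \<P>" "\<And>p w. p \<in> \<P> \<Longrightarrow> w \<in> K \<Longrightarrow> norm (poly p w) \<le> 1"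
      "\<And>z. z \<notin> U \<Longrightarrow> \<exists>p\<in>\<P>. norm (poly p z) > 2"
      using polynomials_separating_from_poly_hull[OF K U] by metis
    define D where "D = (\<Sum>p\<in>\<P>. degree p)"
    have D: "degree p \<le> D" if "p \<in> \<P>" for p
      unfolding D_def using \<P>(1) that by (intro member_le_sum) auto
    define m where "m = diameter K + 1"
    have bK: "bounded K" using K by (simp add: compact_imp_bounded)
    have m: "m > 0" "\<And>x y. x \<in> K \<Longrightarrow> y \<in> K \<Longrightarrow> dist x y \<le> m"
      using diameter_ge_0[OF bK] diameter_bounded_bound[OF bK] by (force simp: m_def)+
    obtain k where k: "2 * m / \<delta> * real (k * D + 1) < 2 ^ k"
      using exponential_beats_linear by blast
    \<comment> \<open>the \<open>k\<close>-th powers of the separating polynomials have degree at most \<open>k * D < d\<close>, as interpolation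
      at \<open>d\<close> points requires\<close>
    define d where "d = k * D + 1"
    obtain t where t: "\<And>i. t i \<in> K" "inj_on t {..<d}"
      and fek: "\<And>i z. i < d \<Longrightarrow> z \<in> K \<Longrightarrow>
       (\<Prod>j\<in>{..<d} - {i}. dist z (t j)) \<le> (\<Prod>j\<in>{..<d} - {i}. dist (t i) (t j))"
      using fekete_points_exist[OF K(1) inf, of d] by metis
    define N where "N i = (\<Prod>j\<in>{..<d} - {i}. dist (t i) (t j))" for i
    have Npos: "N i > 0" if "i < d" for i
      unfolding N_def using t(2) that by (intro prod_pos) (auto dest: inj_onD)
    have "\<exists>i\<in>{..<d}. \<forall>j\<in>{..<d}. N i \<le> N j"
    proof -
      have "Min (N ` {..<d}) \<in> N ` {..<d}" by (rule Min_in) (auto simp: d_def lessThan_empty_iff)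
      then obtain i where "i \<in> {..<d}" "N i = Min (N ` {..<d})" by auto
      then show ?thesis by (intro bexI[of _ i]) auto
    qed
    then obtain i0 where i0: "i0 < d" "\<And>j. j < d \<Longrightarrow> N i0 \<le> N j" by auto
    define F where "F = smult (of_real (1 / (m * N i0))) (\<Prod>j<d. [:- t j, 1:])"
    have mN: "m * N i0 > 0" using m(1) Npos[OF i0(1)] by simp
    have nF: "norm (poly F z) = dist z (t i) * (\<Prod>j\<in>{..<d} - {i}. dist z (t j)) / (m * N i0)"
      if "i < d" for i z
    proof -
      have "norm (poly F z) = (\<Prod>j<d. dist z (t j)) / (m * N i0)"
        using m(1) Npos[OF i0(1)] by (simp add: F_def poly_prod norm_mult norm_divide prod_norm[symmetric] dist_norm)
      then show ?thesis using that by (subst (asm) prod.remove[of _ i]) auto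
    qed
    have "degree F = d"
      using m(1) Npos[OF i0(1)] by (simp add: F_def degree_prod_sum_eq)
    then have "degree F > 0" by (simp add: d_def)
    moreover have "norm (poly F z) \<le> 1" if z: "z \<in> K" for z
    proof -
      have "dist z (t i0) * (\<Prod>j\<in>{..<d} - {i0}. dist z (t j)) \<le> m * N i0"
        unfolding N_def using m(1)
        by (intro mult_mono m(2)[OF z t(1)] fek[OF i0(1) z] prod_nonneg) auto
      then show ?thesis unfolding nF[OF i0(1)] using mN by simp
    qed
    moreover have "z \<in> U" if le2: "norm (poly F z) \<le> 2" for z
    proof (rule ccontr)
      assume z: "z \<notin> U"
      obtain p where p: "p \<in> \<P>" "norm (poly p z) > 2" using \<P>(3)[OF z] by blast
      have "degree (p ^ k) < d"
        using degree_power_le[of p k] D[OF p(1)] mult_le_mono1[of "degree p" D k] unfolding d_def mult.commute[of k] by linarith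
      note lag = lagrange_interpolation[OF t(2) this, of z]
      have "2 ^ k \<le> norm (poly (p ^ k) z)" using p(2) by (simp add: norm_power power_mono)
      also have "\<dots> \<le> (\<Sum>i<d. norm (poly (p ^ k) (t i) * (\<Prod>j\<in>{..<d} - {i}. (z - t j) / (t i - t j))))"
        unfolding lag by (rule norm_sum)
      also have "\<dots> \<le> (\<Sum>i<d. (2 * m / \<delta>))"
      proof (intro sum_mono)
        fix i assume "i \<in> {..<d}"
        then have i: "i < d" by simp
        have "norm (poly (p ^ k) (t i)) \<le> 1" using \<P>(2)[OF p(1) t(1)] by (simp add: norm_power power_le_one)
        then have "norm (poly (p ^ k) (t i) * (\<Prod>j\<in>{..<d} - {i}. (z - t j) / (t i - t j)))
           \<le> 1 * norm (\<Prod>j\<in>{..<d} - {i}. (z - t j) / (t i - t j))"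
          unfolding norm_mult by (intro mult_right_mono) auto
        also have "\<dots> = (\<Prod>j\<in>{..<d} - {i}. dist z (t j)) / N i"
          by (simp add: N_def prod_norm[symmetric] norm_divide prod_dividef dist_norm)
        also have "\<dots> \<le> 2 * m / \<delta>"
        proof -
          have pn: "(\<Prod>j\<in>{..<d} - {i}. dist z (t j)) \<ge> 0" by (intro prod_nonneg) auto
          have "\<delta> * (\<Prod>j\<in>{..<d} - {i}. dist z (t j)) \<le> dist z (t i) * (\<Prod>j\<in>{..<d} - {i}. dist z (t j))"
            using \<delta>(2)[OF t(1) z] pn by (intro mult_right_mono) auto
          also have "\<dots> \<le> 2 * (m * N i0)"
            using le2 mN unfolding nF[OF i] by (simp add: field_simps)
          also have "\<dots> \<le> 2 * (m * N i)" using i0(2)[OF i] m by simp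
          finally show ?thesis using \<delta>(1) Npos[OF i] by (simp add: field_simps)
        qed
        finally show "norm (poly (p ^ k) (t i) * (\<Prod>j\<in>{..<d} - {i}. (z - t j) / (t i - t j))) \<le> 2 * m / \<delta>" .
      qed
      also have "\<dots> = 2 * m / \<delta> * real (k * D + 1)" by (simp add: d_def)
      finally show False using k by simp
    qed
    ultimately show ?thesis using that[of F] by metis
  qed
qed

section \<open>Constructing subharmonic functions\<close>

lemma usc_measurable:
  assumes "usc (u :: complex \<Rightarrow> ereal)"
  shows "u \<in> borel_measurable borel"
  using assms by (intro borel_measurableI_less) (auto simp: usc_def)

text \<open>
  The substitution turns the circle by \<open>\<theta>\<close>; the part of the interval that sticks out beyond \<open>2 pi\<close>
  is moved back by periodicity.
\<close>

lemma nn_integral_rotate: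
  fixes h :: "complex \<Rightarrow> ennreal"
  assumes [measurable]: "h \<in> borel_measurable borel" and \<theta>: "0 \<le> \<theta>" "\<theta> < 2*pi"
  shows "(\<integral>\<^sup>+t. h (cis (t + \<theta>)) \<partial>restrict_space lborel {0..2*pi})
       = (\<integral>\<^sup>+t. h (cis t) \<partial>restrict_space lborel {0..2*pi})"
proof -
  have [measurable]: "cis \<in> borel_measurable borel"
    by (intro borel_measurable_continuous_onI continuous_intros)
  have per: "cis (t + 2*pi) = cis t" for t by (simp add: cis_mult[symmetric])
  have half: "(\<integral>\<^sup>+t. g t \<partial>restrict_space lborel {0..2*pi}) = (\<integral>\<^sup>+t. g t * indicator {0..<2*pi} t \<partial>lborel)"
    if [measurable]: "g \<in> borel_measurable borel" for g :: "real \<Rightarrow> ennreal"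
  proof -
    have "(\<integral>\<^sup>+t. g t \<partial>restrict_space lborel {0..2*pi}) = (\<integral>\<^sup>+t. g t * indicator {0..2*pi} t \<partial>lborel)"
      by (subst nn_integral_restrict_space) auto
    also have "\<dots> = (\<integral>\<^sup>+t. g t * indicator {0..<2*pi} t \<partial>lborel)"
      by (intro nn_integral_cong_AE eventually_mono[OF AE_lborel_singleton[of "2*pi"]])
        (auto simp: indicator_def)
    finally show ?thesis .
  qed
  have "(\<integral>\<^sup>+t. h (cis (t + \<theta>)) \<partial>restrict_space lborel {0..2*pi})
      = (\<integral>\<^sup>+t. h (cis (t + \<theta>)) * indicator {0..<2*pi} t \<partial>lborel)"
    by (rule half) measurable
  also have "\<dots> = (\<integral>\<^sup>+t. h (cis (\<theta> + 1 * t)) * indicator {\<theta>..<2*pi + \<theta>} (\<theta> + 1 * t) \<partial>lborel)"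
    by (intro nn_integral_cong) (auto simp: indicator_def add.commute)
  also have "\<dots> = (\<integral>\<^sup>+t. h (cis t) * indicator {\<theta>..<2*pi + \<theta>} t \<partial>lborel)"
    by (subst (2) nn_integral_real_affine[where c = 1 and t = \<theta>]) auto
  also have "\<dots> = (\<integral>\<^sup>+t. h (cis t) * indicator {\<theta>..<2*pi} t + h (cis t) * indicator {2*pi..<2*pi + \<theta>} t \<partial>lborel)"
    using \<theta> by (intro nn_integral_cong) (auto simp: indicator_def)
  also have "\<dots> = (\<integral>\<^sup>+t. h (cis t) * indicator {\<theta>..<2*pi} t \<partial>lborel)
      + (\<integral>\<^sup>+t. h (cis t) * indicator {2*pi..<2*pi + \<theta>} t \<partial>lborel)"
    by (intro nn_integral_add) auto
  also have "(\<integral>\<^sup>+t. h (cis t) * indicator {2*pi..<2*pi + \<theta>} t \<partial>lborel)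
      = (\<integral>\<^sup>+t. h (cis (2*pi + 1 * t)) * indicator {2*pi..<2*pi + \<theta>} (2*pi + 1 * t) \<partial>lborel)"
    by (subst nn_integral_real_affine[where c = 1 and t = "2*pi"]) auto
  also have "\<dots> = (\<integral>\<^sup>+t. h (cis t) * indicator {0..<\<theta>} t \<partial>lborel)"
    using per by (intro nn_integral_cong) (auto simp: indicator_def add.commute)
  also have "(\<integral>\<^sup>+t. h (cis t) * indicator {\<theta>..<2*pi} t \<partial>lborel) + \<dots>
      = (\<integral>\<^sup>+t. h (cis t) * indicator {\<theta>..<2*pi} t + h (cis t) * indicator {0..<\<theta>} t \<partial>lborel)"
    by (intro nn_integral_add[symmetric]) auto
  also have "\<dots> = (\<integral>\<^sup>+t. h (cis t) * indicator {0..<2*pi} t \<partial>lborel)"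
    using \<theta> by (intro nn_integral_cong) (auto simp: indicator_def)
  also have "\<dots> = (\<integral>\<^sup>+t. h (cis t) \<partial>restrict_space lborel {0..2*pi})"
    by (rule half[symmetric]) measurable
  finally show ?thesis .
qed

lemma circle_mean_const: "circle_mean (\<lambda>_. ereal c) z r = ereal c"
proof -
  have "circle_mean (\<lambda>_. ereal c) z r = ereal (integral {0..2*pi} (\<lambda>_. c) / (2*pi))"
    by (intro circle_mean_continuous) auto
  then show ?thesis by simp
qed

text \<open>
  An affine map \<open>\<zeta> \<mapsto> a + \<zeta> b\<close> maps circles to circles but turns their
  parametrisation by the argument of \<open>b\<close>, so the rotation invariance of the mean enters.
\<close>

lemma circle_mean_affine:
  assumes u: "usc u" and b: "b \<noteq> 0"
  shows "circle_mean (\<lambda>\<zeta>. u (a + \<zeta> * b)) z r = circle_mean u (a + z * b) (r * norm b)"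
proof -
  define \<theta> where "\<theta> = Arg2pi b"
  have \<theta>: "0 \<le> \<theta>" "\<theta> < 2*pi" using Arg2pi by (auto simp: \<theta>_def)
  have bpol: "b = of_real (norm b) * cis \<theta>"
    unfolding \<theta>_def cis_conv_exp using Arg2pi_eq[of b] by (simp add: mult.commute)
  have eq: "a + (z + of_real r * cis t) * b = (a + z * b) + of_real (r * norm b) * cis (t + \<theta>)" for t
    by (subst (1) bpol) (subst (2) bpol, simp add: cis_mult[symmetric] algebra_simps)
  note [measurable] = usc_measurable[OF u]
  have m: "(\<lambda>w. e2ennreal (f (u ((a + z * b) + of_real (r * norm b) * w)))) \<in> borel_measurable borel"
    if [measurable]: "f \<in> borel_measurable borel" for f :: "ereal \<Rightarrow> ereal" by measurable
  have r1: "(\<integral>\<^sup>+t. e2ennreal (u ((a + z * b) + of_real (r * norm b) * cis (t + \<theta>))) \<partial>restrict_space lborel {0..2*pi})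
     = (\<integral>\<^sup>+t. e2ennreal (u ((a + z * b) + of_real (r * norm b) * cis t)) \<partial>restrict_space lborel {0..2*pi})"
    using nn_integral_rotate[OF m[of "\<lambda>x. x"] \<theta>] by simp
  have r2: "(\<integral>\<^sup>+t. e2ennreal (- u ((a + z * b) + of_real (r * norm b) * cis (t + \<theta>))) \<partial>restrict_space lborel {0..2*pi})
     = (\<integral>\<^sup>+t. e2ennreal (- u ((a + z * b) + of_real (r * norm b) * cis t)) \<partial>restrict_space lborel {0..2*pi})"
    using nn_integral_rotate[OF m[of "\<lambda>x. - x"] \<theta>] by simp
  show ?thesis
    unfolding circle_mean_def ereal_integral_def eq r1 r2 ..
qed

lemma subharmonic_affine:
  assumes u: "subharmonic u"
  shows "subharmonic (\<lambda>\<zeta>. u (a + \<zeta> * b))"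
proof (cases "b = 0")
  case True
  have "u a \<noteq> \<infinity>" using u by (auto simp: subharmonic_def less_le)
  then show ?thesis unfolding True
    by (cases "u a") (auto simp: subharmonic_def usc_def circle_mean_const)
next
  case False
  have usc: "usc u" using u by (simp add: subharmonic_def)
  have "usc (\<lambda>\<zeta>. u (a + \<zeta> * b))"
    by (intro usc_compose[OF usc] continuous_intros)
  then show ?thesis
    using u False by (auto simp: subharmonic_def circle_mean_affine[OF usc False])
qed

lemma subharmonic_max_0:
  assumes u: "subharmonic u"
  shows "subharmonic (\<lambda>\<zeta>. max 0 (u \<zeta>))"
  unfolding subharmonic_def
proof (intro conjI allI impI)
  show "usc (\<lambda>\<zeta>. max 0 (u \<zeta>))"
    unfolding usc_def
  proof
    fix c :: ereal
    have "{x. max 0 (u x) < c} = (if 0 < c then {x. u x < c} else {})" by auto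
    then show "open {x. max 0 (u x) < c}" using u by (simp add: subharmonic_def usc_def)
  qed
  show "max 0 (u z) < \<infinity>" for z using u by (auto simp: subharmonic_def max_def)
  fix z :: complex and r :: real assume r: "r > 0"
  have "u z \<le> circle_mean u z r" using u r by (simp add: subharmonic_def)
  also have "\<dots> \<le> circle_mean (\<lambda>\<zeta>. max 0 (u \<zeta>)) z r" by (intro circle_mean_mono) simp
  finally have 1: "u z \<le> circle_mean (\<lambda>\<zeta>. max 0 (u \<zeta>)) z r" .
  have "0 = circle_mean (\<lambda>_. ereal 0) z r" unfolding circle_mean_const by simp
  also have "\<dots> \<le> circle_mean (\<lambda>\<zeta>. max 0 (u \<zeta>)) z r"
    by (intro circle_mean_mono) (auto simp: le_max_iff_disj)
  finally show "max 0 (u z) \<le> circle_mean (\<lambda>\<zeta>. max 0 (u \<zeta>)) z r" using 1 by simp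
qed

text \<open>
  For nonnegative functions the sub-mean value inequality is an inequality between nonnegative
  integrals, where additivity holds without any integrability condition.
\<close>

lemma subharmonic_nonneg_iff:
  fixes w :: "complex \<Rightarrow> real"
  assumes w: "\<And>\<zeta>. 0 \<le> w \<zeta>"
  shows "subharmonic (\<lambda>\<zeta>. ereal (w \<zeta>)) \<longleftrightarrow> usc (\<lambda>\<zeta>. ereal (w \<zeta>)) \<and>
    (\<forall>z. \<forall>r>0. ennreal (2*pi * w z)
       \<le> (\<integral>\<^sup>+t. ennreal (w (z + of_real r * cis t)) \<partial>restrict_space lborel {0..2*pi}))"
proof -
  have "ereal (w z) \<le> circle_mean (\<lambda>\<zeta>. ereal (w \<zeta>)) z r \<longleftrightarrow> ennreal (2*pi * w z)
       \<le> (\<integral>\<^sup>+t. ennreal (w (z + of_real r * cis t)) \<partial>restrict_space lborel {0..2*pi})" (is "_ \<longleftrightarrow> _ \<le> ?I") for z r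
  proof -
    have "ereal_integral (restrict_space lborel {0..2*pi}) (\<lambda>t. ereal (w (z + of_real r * cis t))) = enn2ereal ?I"
      unfolding ereal_integral_def using w by (simp add: e2ennreal_ereal ennreal_neg zero_ennreal.rep_eq)
    then have "ereal (w z) \<le> circle_mean (\<lambda>\<zeta>. ereal (w \<zeta>)) z r \<longleftrightarrow> ereal (w z) \<le> enn2ereal ?I / ereal (2*pi)"
      by (simp add: circle_mean_def)
    also have "\<dots> \<longleftrightarrow> ereal (2*pi) * ereal (w z) \<le> enn2ereal ?I"
      by (intro ereal_le_divide_pos) auto
    also have "ereal (2*pi) * ereal (w z) = enn2ereal (ennreal (2*pi * w z))"
      using w[of z] by (simp add: enn2ereal_ennreal)
    also have "\<dots> \<le> enn2ereal ?I \<longleftrightarrow> ennreal (2*pi * w z) \<le> ?I"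
      by (simp add: less_eq_ennreal.rep_eq)
    finally show ?thesis .
  qed
  then show ?thesis by (simp add: subharmonic_def)
qed

lemma usc_real_add:
  assumes "usc (\<lambda>x. ereal (f x))" "usc (\<lambda>x. ereal (g x))"
  shows "usc (\<lambda>x. ereal (f x + g x))"
  unfolding usc_iff_nhds
proof (intro allI impI)
  fix x c assume less: "ereal (f x + g x) < c"
  then obtain d where d: "f x + g x < d" "ereal d < c"
    using ereal_dense2[of "ereal (f x + g x)" c] by auto
  define e where "e = (d - (f x + g x)) / 2"
  have "ereal (f x) < ereal (f x + e)" "ereal (g x) < ereal (g x + e)" using d by (auto simp: e_def)
  from usc_nhds[OF assms(1) this(1)] usc_nhds[OF assms(2) this(2)]
  show "eventually (\<lambda>y. ereal (f y + g y) < c) (nhds x)"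
  proof eventually_elim
    case (elim y)
    then have "f y + g y < d" by (simp add: e_def field_simps)
    then show ?case using d(2) by (meson ereal_less_le less_ereal.simps(1) less_imp_le less_trans)
  qed
qed

lemma usc_real_cmult:
  assumes "usc (\<lambda>x. ereal (f x))" "c \<ge> 0"
  shows "usc (\<lambda>x. ereal (c * f x))"
proof (cases "c = 0")
  case True
  then show ?thesis by (simp add: usc_def)
next
  case False
  with assms have c: "c > 0" by simp
  have "open {x. ereal (c * f x) < d}" for d
  proof (cases d)
    case (real d')
    have "{x. ereal (c * f x) < d} = {x. ereal (f x) < ereal (d' / c)}"
      using c by (auto simp: real field_simps)
    then show ?thesis using assms(1) by (simp only: usc_def)
  qed auto
  then show ?thesis by (simp add: usc_def)
qed

lemma subharmonic_sum:
  fixes w :: "'j \<Rightarrow> complex \<Rightarrow> real"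
  assumes "finite J" "\<And>j. j \<in> J \<Longrightarrow> subharmonic (\<lambda>\<zeta>. ereal (w j \<zeta>))"
    "\<And>j \<zeta>. j \<in> J \<Longrightarrow> 0 \<le> w j \<zeta>" "\<And>j. j \<in> J \<Longrightarrow> 0 \<le> x j"
  shows "subharmonic (\<lambda>\<zeta>. ereal (\<Sum>j\<in>J. x j * w j \<zeta>))"
  using assms
proof (induction rule: finite_induct)
  case empty
  have "subharmonic (\<lambda>_. ereal 0)"
    unfolding subharmonic_def circle_mean_const by (auto simp: usc_def)
  then show ?case by simp
next
  case (insert i J)
  define f where "f \<zeta> = (\<Sum>j\<in>J. x j * w j \<zeta>)" for \<zeta>
  have f0: "0 \<le> f \<zeta>" for \<zeta> unfolding f_def using insert.prems by (intro sum_nonneg mult_nonneg_nonneg) auto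
  have fs: "subharmonic (\<lambda>\<zeta>. ereal (f \<zeta>))" unfolding f_def using insert by auto
  have g0: "0 \<le> w i \<zeta>" for \<zeta> using insert.prems by auto
  have gs: "subharmonic (\<lambda>\<zeta>. ereal (w i \<zeta>))" using insert.prems by auto
  have xi: "0 \<le> x i" using insert.prems by auto
  note fs' = fs[unfolded subharmonic_nonneg_iff[OF f0]]
  note gs' = gs[unfolded subharmonic_nonneg_iff[OF g0]]
  have h0: "0 \<le> x i * w i \<zeta> + f \<zeta>" for \<zeta> using xi f0 g0 by auto
  have "subharmonic (\<lambda>\<zeta>. ereal (x i * w i \<zeta> + f \<zeta>))"
    unfolding subharmonic_nonneg_iff[OF h0]
  proof (intro conjI allI impI)
    show "usc (\<lambda>\<zeta>. ereal (x i * w i \<zeta> + f \<zeta>))"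
      using fs' gs' xi by (intro usc_real_add usc_real_cmult) auto
    fix z :: complex and r :: real assume r: "r > 0"
    let ?M = "restrict_space lborel {0..2*pi}"
    have [measurable]: "f \<in> borel_measurable borel" "w i \<in> borel_measurable borel"
      using usc_measurable[of "\<lambda>\<zeta>. ereal (f \<zeta>)"] usc_measurable[of "\<lambda>\<zeta>. ereal (w i \<zeta>)"] fs' gs'
      by (auto simp: borel_measurable_ereal_iff)
    have [measurable]: "cis \<in> borel_measurable borel"
      by (intro borel_measurable_continuous_onI continuous_intros)
    have m: "(\<lambda>t. ennreal (k (z + of_real r * cis t))) \<in> borel_measurable ?M"
      if [measurable]: "k \<in> borel_measurable borel" for k :: "complex \<Rightarrow> real"
      by (intro measurable_restrict_space1) measurable
    have "ennreal (2*pi * (x i * w i z + f z)) = ennreal (x i) * ennreal (2*pi * w i z) + ennreal (2*pi * f z)"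
      using xi f0 g0 by (simp add: ennreal_mult[symmetric] ennreal_plus[symmetric] algebra_simps del: ennreal_plus)
    also have "\<dots> \<le> ennreal (x i) * (\<integral>\<^sup>+t. ennreal (w i (z + of_real r * cis t)) \<partial>?M)
        + (\<integral>\<^sup>+t. ennreal (f (z + of_real r * cis t)) \<partial>?M)"
      using fs' gs' r by (intro add_mono mult_left_mono) auto
    also have "ennreal (x i) * (\<integral>\<^sup>+t. ennreal (w i (z + of_real r * cis t)) \<partial>?M)
        = (\<integral>\<^sup>+t. ennreal (x i) * ennreal (w i (z + of_real r * cis t)) \<partial>?M)"
      by (rule nn_integral_cmult[symmetric]) (rule m, measurable)
    also have "\<dots> = (\<integral>\<^sup>+t. ennreal (x i * w i (z + of_real r * cis t)) \<partial>?M)"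
      using xi g0 by (intro nn_integral_cong) (simp add: ennreal_mult)
    also have "\<dots> + (\<integral>\<^sup>+t. ennreal (f (z + of_real r * cis t)) \<partial>?M)
        = (\<integral>\<^sup>+t. ennreal (x i * w i (z + of_real r * cis t)) + ennreal (f (z + of_real r * cis t)) \<partial>?M)"
      by (rule nn_integral_add[symmetric]; rule m) measurable
    also have "\<dots> = (\<integral>\<^sup>+t. ennreal (x i * w i (z + of_real r * cis t) + f (z + of_real r * cis t)) \<partial>?M)"
      using xi f0 g0 by (intro nn_integral_cong ennreal_plus[symmetric]) auto
    finally show "ennreal (2*pi * (x i * w i z + f z))
       \<le> (\<integral>\<^sup>+t. ennreal (x i * w i (z + of_real r * cis t) + f (z + of_real r * cis t)) \<partial>?M)" .
  qed
  then show ?case using insert by (simp add: f_def)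
qed

text \<open>
  On a complex line each summand is a subharmonic function of one variable composed with an
  affine map.
\<close>

lemma plurisubharmonic_separate_sum:
  fixes w :: "'n::finite \<Rightarrow> complex \<Rightarrow> real"
  assumes sh: "\<And>j. subharmonic (\<lambda>\<zeta>. ereal (w j \<zeta>))" and w: "\<And>j \<zeta>. 0 \<le> w j \<zeta>" and x: "\<And>j. 0 \<le> x j"
  shows "plurisubharmonic (\<lambda>z :: complex ^ 'n. ereal (\<Sum>j\<in>UNIV. x j * w j (z $ j)))"
  unfolding plurisubharmonic_def
proof (intro conjI allI)
  have "usc (\<lambda>z :: complex ^ 'n. ereal (\<Sum>j\<in>J. x j * w j (z $ j)))" if "finite J" for J
    using that
  proof (induction rule: finite_induct)
    case empty
    then show ?case by (simp add: usc_def)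
  next
    case (insert i J)
    have "usc (\<lambda>\<zeta>. ereal (w i \<zeta>))" using sh[of i] by (simp add: subharmonic_def)
    then have "usc (\<lambda>z :: complex ^ 'n. ereal (w i (z $ i)))"
      by (rule usc_compose) (intro continuous_intros)
    then have "usc (\<lambda>z :: complex ^ 'n. ereal (x i * w i (z $ i)))"
      by (rule usc_real_cmult) (rule x)
    then have "usc (\<lambda>z :: complex ^ 'n. ereal (x i * w i (z $ i) + (\<Sum>j\<in>J. x j * w j (z $ j))))"
      by (rule usc_real_add) (rule insert.IH)
    then show ?case using insert by simp
  qed
  then show "usc (\<lambda>z :: complex ^ 'n. ereal (\<Sum>j\<in>UNIV. x j * w j (z $ j)))" by simp
  fix a b :: "complex ^ 'n"
  show "subharmonic (\<lambda>\<zeta>. ereal (\<Sum>j\<in>UNIV. x j * w j ((a + \<zeta> *s b) $ j)))"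
    using subharmonic_affine[OF sh] by (intro subharmonic_sum) (auto simp: w x)
qed auto

section \<open>Polynomials as competitors in the one-variable class\<close>

text \<open>
  If \<open>a\<close> lies outside the circle, \<open>ln \<bar>a + \<zeta>\<bar>\<close> is harmonic on the disc. If it lies inside, reflecting
  \<open>a\<close> in the circle makes the logarithm harmonic, and the mean is \<open>ln r\<close>, which is larger than \<open>ln \<bar>a\<bar>\<close>.
\<close>

lemma integral_ln_norm_linear:
  fixes a :: complex
  assumes r: "r > 0" and a: "a \<noteq> 0" "norm a \<noteq> r"
  shows "2*pi * ln (norm a) \<le> integral {0..2*pi} (\<lambda>t. ln (norm (a + of_real r * cis t)))"
proof (cases "r < norm a")
  case True
  have nonpos: "1 + \<zeta> / a \<notin> \<real>\<^sub>\<le>\<^sub>0" if "norm \<zeta> \<le> r" for \<zeta>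
  proof
    assume "1 + \<zeta> / a \<in> \<real>\<^sub>\<le>\<^sub>0"
    then have "Re (\<zeta> / a) \<le> -1" by (simp add: complex_nonpos_Reals_iff)
    moreover have "\<bar>Re (\<zeta> / a)\<bar> \<le> norm (\<zeta> / a)" by (rule abs_Re_le_cmod)
    moreover have "norm (\<zeta> / a) < 1" using that True a by (simp add: norm_divide)
    ultimately show False by linarith
  qed
  have hol: "(\<lambda>\<zeta>. Ln (1 + \<zeta> / a)) holomorphic_on cball 0 r"
    by (intro holomorphic_intros) (use a nonpos in auto)
  have "((\<lambda>t. Re (Ln (1 + (0 + of_real r * cis t) / a))) has_integral 0) {0..2*pi}"
    using has_integral_Re[OF holomorphic_circle_mean_value[OF hol r]] by simp
  from has_integral_add[OF has_integral_const_real[of "ln (norm a)" 0 "2*pi"] this]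
  have "((\<lambda>t. ln (norm a) + Re (Ln (1 + (0 + of_real r * cis t) / a))) has_integral 2*pi * ln (norm a)) {0..2*pi}"
    by simp
  moreover have "ln (norm a) + Re (Ln (1 + (0 + of_real r * cis t) / a)) = ln (norm (a + of_real r * cis t))" for t
  proof -
    have "norm (of_real r * cis t) \<le> r" using r by (simp add: norm_mult)
    then have nz: "1 + of_real r * cis t / a \<noteq> 0" using nonpos[of "of_real r * cis t"] by auto
    then have "Re (Ln (1 + (0 + of_real r * cis t) / a)) = ln (norm (1 + of_real r * cis t / a))" by simp
    moreover have "ln (norm a) + ln (norm (1 + of_real r * cis t / a)) = ln (norm (a * (1 + of_real r * cis t / a)))"
      using nz a by (simp add: norm_mult ln_mult)
    moreover have "a * (1 + of_real r * cis t / a) = a + of_real r * cis t" using a by (simp add: field_simps)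
    ultimately show ?thesis by simp
  qed
  ultimately have "((\<lambda>t. ln (norm (a + of_real r * cis t))) has_integral 2*pi * ln (norm a)) {0..2*pi}"
    by simp
  then show ?thesis by (simp add: integral_unique)
next
  case False
  then have ar: "norm a < r" using a by simp
  define b where "b = cnj a / of_real r"
  have nb: "norm b < 1" using ar r by (simp add: b_def norm_divide)
  have nonpos: "1 + b * \<zeta> \<notin> \<real>\<^sub>\<le>\<^sub>0" if "norm \<zeta> \<le> 1" for \<zeta>
  proof
    assume "1 + b * \<zeta> \<in> \<real>\<^sub>\<le>\<^sub>0"
    then have "Re (b * \<zeta>) \<le> -1" by (simp add: complex_nonpos_Reals_iff)
    moreover have "\<bar>Re (b * \<zeta>)\<bar> \<le> norm (b * \<zeta>)" by (rule abs_Re_le_cmod)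
    moreover have "norm (b * \<zeta>) \<le> norm b * 1" unfolding norm_mult using that by (intro mult_left_mono) auto
    ultimately show False using nb by linarith
  qed
  have hol: "(\<lambda>\<zeta>. Ln (1 + b * \<zeta>)) holomorphic_on cball 0 1"
    by (intro holomorphic_intros) (use nonpos in auto)
  have "((\<lambda>t. Re (Ln (1 + b * (0 + of_real 1 * cis t)))) has_integral 0) {0..2*pi}"
    using has_integral_Re[OF holomorphic_circle_mean_value[OF hol]] by simp
  from has_integral_add[OF has_integral_const_real[of "ln r" 0 "2*pi"] this]
  have "((\<lambda>t. ln r + Re (Ln (1 + b * (0 + of_real 1 * cis t)))) has_integral 2*pi * ln r) {0..2*pi}"
    by simp
  moreover have "ln r + Re (Ln (1 + b * (0 + of_real 1 * cis t))) = ln (norm (a + of_real r * cis t))" for t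
  proof -
    have nz: "1 + b * cis t \<noteq> 0" using nonpos[of "cis t"] by auto
    then have "Re (Ln (1 + b * (0 + of_real 1 * cis t))) = ln (norm (1 + b * cis t))" by simp
    moreover have "ln r + ln (norm (1 + b * cis t)) = ln (norm (of_real r * (1 + b * cis t)))"
      using nz r by (simp add: norm_mult ln_mult)
    moreover have "norm (of_real r * (1 + b * cis t)) = norm (a + of_real r * cis t)"
    proof -
      have "of_real r * (1 + b * cis t) = cis t * cnj (a + of_real r * cis t)"
        using r by (simp add: b_def algebra_simps cis_cnj cis_mult)
      then show ?thesis by (simp add: norm_mult del: complex_cnj_add)
    qed
    ultimately show ?thesis by simp
  qed
  ultimately have "((\<lambda>t. ln (norm (a + of_real r * cis t))) has_integral 2*pi * ln r) {0..2*pi}"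
    by simp
  then have "integral {0..2*pi} (\<lambda>t. ln (norm (a + of_real r * cis t))) = 2*pi * ln r"
    by (rule integral_unique)
  moreover have "ln (norm a) \<le> ln r" using ar a by (intro ln_mono) auto
  ultimately show ?thesis by simp
qed

lemma integral_ln_norm_poly:
  fixes p :: "complex poly"
  assumes r: "r > 0" and z: "poly p z \<noteq> 0" and circ: "\<And>t. poly p (z + of_real r * cis t) \<noteq> 0"
  shows "2*pi * ln (norm (poly p z)) \<le> integral {0..2*pi} (\<lambda>t. ln (norm (poly p (z + of_real r * cis t))))"
proof -
  have cont: "continuous_on {0..2*pi} (\<lambda>t. ln (norm (poly q (z + of_real r * cis t))))"
    if "\<And>t. poly q (z + of_real r * cis t) \<noteq> 0" for q
    using that by (intro continuous_intros) auto
  have main: "poly (\<Prod>x\<in>#A. [:- x, 1:]) z \<noteq> 0 \<Longrightarrow> (\<And>t. poly (\<Prod>x\<in>#A. [:- x, 1:]) (z + of_real r * cis t) \<noteq> 0) \<Longrightarrow>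
    2*pi * ln (norm (poly (\<Prod>x\<in>#A. [:- x, 1:]) z))
      \<le> integral {0..2*pi} (\<lambda>t. ln (norm (poly (\<Prod>x\<in>#A. [:- x, 1:]) (z + of_real r * cis t))))" for A
  proof (induction A)
    case empty
    then show ?case by simp
  next
    case (add x A)
    let ?q = "\<Prod>x\<in>#A. [:- x, 1:]"
    have q: "poly ?q z \<noteq> 0" "\<And>t. poly ?q (z + of_real r * cis t) \<noteq> 0" using add.prems by auto
    have zx: "z - x \<noteq> 0" using add.prems(1) by auto
    have cx: "z + of_real r * cis t - x \<noteq> 0" for t using add.prems(2)[of t] by auto
    \<comment> \<open>otherwise \<open>x\<close> would be a zero on the circle\<close>
    have "norm (z - x) \<noteq> r"
    proof
      assume n: "norm (z - x) = r"
      have "z - x = of_real r * cis (Arg (z - x))"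
        using rcis_cmod_Arg[of "z - x"] by (simp add: rcis_def n)
      then have "z + of_real r * cis (Arg (z - x) + pi) - x = 0"
        by (simp add: cis_mult[symmetric])
      then show False using cx by blast
    qed
    from integral_ln_norm_linear[OF r zx this] add.IH[OF q]
    have "2*pi * ln (norm (z - x)) + 2*pi * ln (norm (poly ?q z))
       \<le> integral {0..2*pi} (\<lambda>t. ln (norm (z - x + of_real r * cis t)))
        + integral {0..2*pi} (\<lambda>t. ln (norm (poly ?q (z + of_real r * cis t))))" by linarith
    also have "\<dots> = integral {0..2*pi} (\<lambda>t. ln (norm (z - x + of_real r * cis t)) + ln (norm (poly ?q (z + of_real r * cis t))))"
    proof (rule integral_add[symmetric]; rule integrable_continuous_real)
      show "continuous_on {0..2*pi} (\<lambda>t. ln (norm (z - x + of_real r * cis t)))"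
        using cx by (intro continuous_intros) (auto simp: algebra_simps)
    qed (rule cont[OF q(2)])
    also have "\<dots> = integral {0..2*pi} (\<lambda>t. ln (norm (poly (\<Prod>x\<in>#add_mset x A. [:- x, 1:]) (z + of_real r * cis t))))"
    proof (rule arg_cong[where f = "integral {0..2*pi}"], rule ext)
      fix t
      have "poly (\<Prod>x\<in>#add_mset x A. [:- x, 1:]) (z + of_real r * cis t)
          = (z - x + of_real r * cis t) * poly ?q (z + of_real r * cis t)"
        by (simp add: algebra_simps)
      moreover have "z - x + of_real r * cis t \<noteq> 0" using cx[of t] by (simp add: algebra_simps)
      ultimately show "ln (norm (z - x + of_real r * cis t)) + ln (norm (poly ?q (z + of_real r * cis t)))
          = ln (norm (poly (\<Prod>x\<in>#add_mset x A. [:- x, 1:]) (z + of_real r * cis t)))"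
        using q(2)[of t] by (simp only: norm_mult) (simp add: ln_mult)
    qed
    finally have *: "2*pi * ln (norm (z - x)) + 2*pi * ln (norm (poly ?q z)) \<le> \<dots>" .
    have "poly (\<Prod>x\<in>#add_mset x A. [:- x, 1:]) z = (z - x) * poly ?q z" by (simp add: algebra_simps)
    then have "2*pi * ln (norm (poly (\<Prod>x\<in>#add_mset x A. [:- x, 1:]) z)) = 2*pi * ln (norm (z - x)) + 2*pi * ln (norm (poly ?q z))"
      using zx q(1) by (simp only: norm_mult) (simp add: ln_mult distrib_left)
    with * show ?case by simp
  qed
  define q where "q = (\<Prod>x\<in>#proots p. [:- x, 1:])"
  define c where "c = lead_coeff p"
  have p: "poly p w = c * poly q w" for w
    unfolding q_def c_def by (subst complex_poly_decompose_multiset[of p, symmetric]) simp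
  have c: "c \<noteq> 0" and qz: "poly q z \<noteq> 0" and qc: "\<And>t. poly q (z + of_real r * cis t) \<noteq> 0"
    using z circ by (auto simp: p)
  have "integral {0..2*pi} (\<lambda>t. ln (norm (poly p (z + of_real r * cis t))))
      = integral {0..2*pi} (\<lambda>t. ln (norm c) + ln (norm (poly q (z + of_real r * cis t))))"
    using c qc by (simp add: p norm_mult ln_mult)
  also have "\<dots> = 2*pi * ln (norm c) + integral {0..2*pi} (\<lambda>t. ln (norm (poly q (z + of_real r * cis t))))"
    by (subst integral_add) (auto intro!: integrable_continuous_real cont qc)
  also have "\<dots> \<ge> 2*pi * ln (norm c) + 2*pi * ln (norm (poly q z))"
    using main[of "proots p"] qz qc unfolding q_def by simp
  also have "2*pi * ln (norm c) + 2*pi * ln (norm (poly q z)) = 2*pi * ln (norm (poly p z))"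
    using c qz by (simp add: p norm_mult ln_mult distrib_left)
  finally show ?thesis .
qed

text \<open>
  On circles free of zeros the inequality follows from the one for \<open>ln \<bar>p\<bar>\<close>. Only finitely many
  radii are excluded, and the mean of a continuous function depends continuously on the radius.
\<close>

lemma subharmonic_ln_max_1_poly:
  fixes p :: "complex poly"
  assumes p: "p \<noteq> 0"
  shows "subharmonic (\<lambda>\<zeta>. ereal (ln (max 1 (norm (poly p \<zeta>)))))"
proof -
  define \<psi> where "\<psi> \<zeta> = ln (max 1 (norm (poly p \<zeta>)))" for \<zeta>
  have \<psi>0: "\<psi> \<zeta> \<ge> 0" for \<zeta> by (simp add: \<psi>_def)
  have \<psi>cont: "continuous_on UNIV \<psi>" unfolding \<psi>_def by (intro continuous_intros) auto
  have cont: "continuous_on {0..2*pi} (\<lambda>t. \<psi> (z + of_real r * cis t))" for z r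
    by (intro continuous_on_compose2[OF \<psi>cont] continuous_intros) auto
  have cm: "circle_mean (\<lambda>\<zeta>. ereal (\<psi> \<zeta>)) z r = ereal (integral {0..2*pi} (\<lambda>t. \<psi> (z + of_real r * cis t)) / (2*pi))" for z r
    by (intro circle_mean_continuous cont) simp
  have "2*pi * \<psi> z \<le> integral {0..2*pi} (\<lambda>t. \<psi> (z + of_real r * cis t))" if r: "r > 0" for z r
  proof (cases "norm (poly p z) \<le> 1")
    case True
    then have "\<psi> z = 0" by (simp add: \<psi>_def)
    moreover have "integral {0..2*pi} (\<lambda>t. \<psi> (z + of_real r * cis t)) \<ge> 0"
      by (intro integral_nonneg integrable_continuous_real cont) (simp add: \<psi>0)
    ultimately show ?thesis by simp
  next
    case False
    then have pz: "poly p z \<noteq> 0" and \<psi>z: "\<psi> z = ln (norm (poly p z))" by (auto simp: \<psi>_def max_def)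
    define I where "I s = integral {0..2*pi} (\<lambda>t. \<psi> (z + of_real s * cis t))" for s
    have "continuous_on UNIV (\<lambda>s. integral (cbox 0 (2*pi)) (\<lambda>t. \<psi> (z + of_real s * cis t)))"
      by (rule integral_continuous_on_param)
        (auto intro!: continuous_on_compose2[OF \<psi>cont] continuous_intros simp: case_prod_unfold)
    then have "isCont I r" by (simp add: continuous_on_eq_continuous_at I_def[abs_def])
    then have lim: "(I \<longlongrightarrow> I r) (at r)" by (simp add: isCont_def)
    have good: "2*pi * \<psi> z \<le> I s" if s: "s > 0" "s \<notin> (\<lambda>x. norm (x - z)) ` {x. poly p x = 0}" for s
    proof -
      have nz: "poly p (z + of_real s * cis t) \<noteq> 0" for t
      proof
        assume "poly p (z + of_real s * cis t) = 0"
        moreover have "norm (z + of_real s * cis t - z) = s" using s by (simp add: norm_mult)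
        ultimately show False using s(2) by (metis (mono_tags, lifting) imageI mem_Collect_eq)
      qed
      have "2*pi * \<psi> z \<le> integral {0..2*pi} (\<lambda>t. ln (norm (poly p (z + of_real s * cis t))))"
        unfolding \<psi>z by (rule integral_ln_norm_poly[OF s(1) pz nz])
      also have "\<dots> \<le> I s"
        unfolding I_def
      proof (intro integral_le integrable_continuous_real cont)
        show "continuous_on {0..2*pi} (\<lambda>t. ln (norm (poly p (z + of_real s * cis t))))"
          using nz by (intro continuous_intros) auto
        show "ln (norm (poly p (z + of_real s * cis t))) \<le> \<psi> (z + of_real s * cis t)" for t
          unfolding \<psi>_def using nz by (intro ln_mono) auto
      qed
      finally show ?thesis .
    qed
    have "finite ((\<lambda>x. norm (x - z)) ` {x. poly p x = 0})" using poly_roots_finite[OF p] by simp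
    then have "eventually (\<lambda>s. s \<notin> (\<lambda>x. norm (x - z)) ` {x. poly p x = 0}) (at r)"
      using islimpt_finite by (simp add: islimpt_iff_eventually)
    moreover have "eventually (\<lambda>s. s > 0) (at r)"
      using r by (intro order_tendstoD(1)[OF tendsto_ident_at])
    ultimately have "eventually (\<lambda>s. 2*pi * \<psi> z \<le> I s) (at r)"
      by eventually_elim (rule good)
    then have "2*pi * \<psi> z \<le> I r"
      by (intro tendsto_lowerbound[OF lim]) auto
    then show ?thesis by (simp add: I_def)
  qed
  then have "ereal (\<psi> z) \<le> circle_mean (\<lambda>\<zeta>. ereal (\<psi> \<zeta>)) z r" if "r > 0" for z r
    using that by (simp add: cm field_simps)
  moreover have "usc (\<lambda>\<zeta>. ereal (\<psi> \<zeta>))"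
    unfolding usc_def
  proof
    fix c :: ereal
    have "open {x. ereal (\<psi> x) < c}"
      by (intro open_Collect_less continuous_intros \<psi>cont)
    then show "open {x. ereal (\<psi> x) < c}" .
  qed
  ultimately show ?thesis by (simp add: subharmonic_def \<psi>_def)
qed

lemma max_0_ln: "x \<ge> 0 \<Longrightarrow> max 0 (ln x) = ln (max 1 x)" for x :: real
  by (cases "x \<ge> 1") (auto simp: max_def ln_le_zero_iff not_le le_less)

text \<open>
  Both estimates express that \<open>p\<close> grows like its leading term: the lower one bounds \<open>u\<close> on large
  lemniscates, the upper one puts the positive part of \<open>ln \<bar>p\<bar> / degree p\<close> into the Lelong class.
\<close>

lemma poly_growth:
  fixes p :: "complex poly"
  assumes d: "degree p > 0"
  obtains C where "\<And>\<zeta>. ln (max 1 (norm (poly p \<zeta>))) \<le> degree p * max 0 (ln (norm \<zeta>)) + C"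
    "\<And>\<zeta>. degree p * max 0 (ln (norm \<zeta>)) \<le> ln (max 1 (norm (poly p \<zeta>))) + C" "C \<ge> 0"
proof -
  define n where "n = degree p"
  define L where "L = norm (lead_coeff p)"
  have L: "L > 0" using d by (auto simp: L_def)
  obtain m where m: "n = Suc m" using d by (cases n) (auto simp: n_def)
  obtain M where M: "\<And>z. M \<le> norm z \<Longrightarrow> norm (\<Sum>i\<le>m. coeff p i * z ^ i) \<le> L / 2 * norm z ^ Suc m"
    using polyfun_extremal_lemma[of "L / 2" "coeff p" m] L by auto
  have split: "poly p z = (\<Sum>i\<le>m. coeff p i * z ^ i) + lead_coeff p * z ^ n" for z
  proof -
    have "degree p = Suc m" using m by (simp add: n_def)
    then show ?thesis by (simp add: poly_altdef n_def)
  qed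
  define R where "R = max M 1"
  have R: "R \<ge> 1" "R \<ge> M" by (auto simp: R_def)
  have big: "L / 2 * norm z ^ n \<le> norm (poly p z)" "norm (poly p z) \<le> 3 / 2 * L * norm z ^ n" if "R \<le> norm z" for z
  proof -
    have "norm (lead_coeff p * z ^ n) = L * norm z ^ n" by (simp add: L_def norm_mult norm_power)
    moreover have "norm (\<Sum>i\<le>m. coeff p i * z ^ i) \<le> L / 2 * norm z ^ n" using M[of z] that R m by simp
    moreover note norm_triangle_ineq[of "\<Sum>i\<le>m. coeff p i * z ^ i" "lead_coeff p * z ^ n"]
      norm_triangle_ineq4[of "poly p z" "\<Sum>i\<le>m. coeff p i * z ^ i"]
    ultimately show "L / 2 * norm z ^ n \<le> norm (poly p z)" "norm (poly p z) \<le> 3 / 2 * L * norm z ^ n"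
      using split[of z] by (simp_all add: algebra_simps)
  qed
  have "bounded (poly p ` cball 0 R)"
    by (intro compact_imp_bounded compact_continuous_image continuous_intros) auto
  then obtain B where B: "\<And>z. z \<in> cball 0 R \<Longrightarrow> norm (poly p z) \<le> B" unfolding bounded_iff by blast
  define C where "C = ln (max 1 B) + ln (max 1 (3 / 2 * L)) + \<bar>ln (2 / L)\<bar> + n * ln R"
  have parts: "ln (max 1 B) \<ge> 0" "ln (max 1 (3 / 2 * L)) \<ge> 0" "\<bar>ln (2 / L)\<bar> \<ge> 0" "n * ln R \<ge> 0"
    using R by auto
  have "ln (max 1 (norm (poly p z))) \<le> n * max 0 (ln (norm z)) + C
      \<and> n * max 0 (ln (norm z)) \<le> ln (max 1 (norm (poly p z))) + C" for z
  proof (cases "R \<le> norm z")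
    case True
    then have z1: "norm z \<ge> 1" using R by simp
    have mx: "max 0 (ln (norm z)) = ln (norm z)" using z1 by simp
    have zn: "norm z ^ n \<ge> 1" using z1 by simp
    have "max 1 (norm (poly p z)) \<le> max 1 (3 / 2 * L) * norm z ^ n"
    proof -
      have "3 / 2 * L * norm z ^ n \<le> max 1 (3 / 2 * L) * norm z ^ n" using zn by (intro mult_right_mono) auto
      moreover have "1 * 1 \<le> max 1 (3 / 2 * L) * norm z ^ n" using zn by (intro mult_mono) auto
      ultimately show ?thesis using big(2)[OF True] by simp
    qed
    then have "ln (max 1 (norm (poly p z))) \<le> ln (max 1 (3 / 2 * L) * norm z ^ n)" by (intro ln_mono) auto
    also have "\<dots> = ln (max 1 (3 / 2 * L)) + n * ln (norm z)"
      using z1 by (subst ln_mult) (auto simp: ln_realpow)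
    finally have 1: "ln (max 1 (norm (poly p z))) \<le> n * ln (norm z) + C"
      using parts unfolding C_def by linarith
    have "norm z ^ n \<le> 2 / L * max 1 (norm (poly p z))"
      using big(1)[OF True] L by (simp add: field_simps max_def)
    then have "ln (norm z ^ n) \<le> ln (2 / L * max 1 (norm (poly p z)))" using zn by (intro ln_mono) auto
    also have "\<dots> = ln (2 / L) + ln (max 1 (norm (poly p z)))"
      using L by (intro ln_mult_pos) auto
    finally have "n * ln (norm z) \<le> ln (2 / L) + ln (max 1 (norm (poly p z)))" using z1 by (simp add: ln_realpow)
    then have 2: "n * ln (norm z) \<le> ln (max 1 (norm (poly p z))) + C"
      using parts unfolding C_def by linarith
    show ?thesis using 1 2 mx by simp
  next
    case False
    have "ln (max 1 (norm (poly p z))) \<le> ln (max 1 B)"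
      using B[of z] False by (intro ln_mono) auto
    moreover have "max 0 (ln (norm z)) \<le> ln R"
      using False R unfolding max_0_ln[OF norm_ge_zero] by (intro ln_mono) auto
    then have "n * max 0 (ln (norm z)) \<le> n * ln R" by (intro mult_left_mono) auto
    moreover have "n * max 0 (ln (norm z)) \<ge> 0" by simp
    moreover have "ln (max 1 (norm (poly p z))) \<ge> 0" by simp
    ultimately show ?thesis using parts unfolding C_def by linarith
  qed
  moreover have "C \<ge> 0" using parts unfolding C_def by linarith
  ultimately show ?thesis using that[of C] unfolding n_def by blast
qed

lemma poly_le_siciak_zakharyuta1:
  fixes p :: "complex poly"
  assumes d: "degree p > 0" and K: "\<And>w. w \<in> K \<Longrightarrow> norm (poly p w) \<le> 1"
  shows "ereal (ln (max 1 (norm (poly p z))) / degree p) \<le> siciak_zakharyuta1 K z"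
proof -
  define w where "w \<zeta> = ln (max 1 (norm (poly p \<zeta>)))" for \<zeta>
  define u where "u = (\<lambda>\<zeta>. ereal (w \<zeta> / degree p))"
  have p0: "p \<noteq> 0" using d by auto
  have "subharmonic (\<lambda>\<zeta>. ereal (\<Sum>j\<in>{()}. 1 / degree p * w \<zeta>))"
    using subharmonic_ln_max_1_poly[OF p0] by (intro subharmonic_sum) (auto simp: w_def)
  then have "subharmonic u" by (simp add: u_def)
  moreover obtain C where C: "\<And>\<zeta>. w \<zeta> \<le> degree p * max 0 (ln (norm \<zeta>)) + C"
    using poly_growth[OF d] unfolding w_def by metis
  have "u \<zeta> \<le> ereal (max 0 (ln (norm \<zeta>)) + C / degree p)" for \<zeta>
    using C[of \<zeta>] d by (simp add: u_def field_simps)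
  then have "\<exists>c. \<forall>\<zeta>. u \<zeta> \<le> ereal (max 0 (ln (norm \<zeta>)) + c)" by blast
  ultimately have "u \<in> lelong_class1" by (simp add: lelong_class1_def)
  moreover have "\<forall>\<zeta>\<in>K. u \<zeta> \<le> 0" using K by (simp add: u_def w_def)
  ultimately have "u z \<le> siciak_zakharyuta1 K z"
    unfolding siciak_zakharyuta1_def by (intro SUP_upper) auto
  then show ?thesis by (simp add: u_def w_def)
qed

section \<open>Supporting functions of bounded lower sets\<close>

text \<open>
  A point is approached inside \<open>cstar\<close> along the real diagonal direction, so an upper limit along
  \<open>cstar\<close> is not vacuous.
\<close>

lemma cstar_not_trivial: "at z within (cstar :: (complex ^ 'n::finite) set) \<noteq> bot"
proof -
  have "z islimpt (cstar :: (complex ^ 'n) set)"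
    unfolding islimpt_approachable
  proof (intro allI impI)
    fix e :: real assume e: "e > 0"
    define w where "w t = (\<chi> j. z $ j + of_real t)" for t :: real
    have "((\<lambda>t. w t $ j) \<longlongrightarrow> z $ j) (at 0)" for j
    proof -
      have "((\<lambda>t. z $ j + of_real t) \<longlongrightarrow> z $ j + of_real 0) (at 0)" by (intro tendsto_intros)
      then show ?thesis by (simp add: w_def)
    qed
    then have "(w \<longlongrightarrow> z) (at 0)" by (rule vec_tendstoI)
    then have "eventually (\<lambda>t. dist (w t) z < e) (at 0)" using e by (rule tendstoD)
    moreover have "eventually (\<lambda>t. \<forall>j. z $ j + of_real t \<noteq> 0) (at 0)"
    proof (intro eventually_all_finite)
      fix j
      show "eventually (\<lambda>t. z $ j + of_real t \<noteq> 0) (at (0::real))"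
      proof (cases "z $ j = 0")
        case True
        then show ?thesis by (auto simp: eventually_at_filter)
      next
        case False
        have "((\<lambda>t :: real. z $ j + of_real t) \<longlongrightarrow> z $ j + of_real 0) (at 0)" by (intro tendsto_intros)
        then show ?thesis using False by (intro tendsto_imp_eventually_ne[where c = "z $ j"]) auto
      qed
    qed
    moreover have "eventually (\<lambda>t :: real. t \<noteq> 0) (at 0)" by (simp add: eventually_at_filter)
    ultimately have "eventually (\<lambda>t. dist (w t) z < e \<and> (\<forall>j. z $ j + of_real t \<noteq> 0) \<and> t \<noteq> 0) (at 0)"
      by (intro eventually_conj)
    then obtain t where t: "dist (w t) z < e" "\<forall>j. z $ j + of_real t \<noteq> 0" "t \<noteq> 0"
      using eventually_happens[of _ "at (0::real)"] by auto
    have "w t \<in> cstar" using t(2) by (simp add: cstar_def w_def)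
    moreover have "w t \<noteq> z" using t(3) by (auto simp: w_def vec_eq_iff)
    ultimately show "\<exists>x'\<in>cstar. x' \<noteq> z \<and> dist x' z < e" using t(1) by blast
  qed
  then show ?thesis by (simp add: trivial_limit_within)
qed

lemma ln_max_1_perturb:
  fixes a b :: complex
  assumes "norm (a - b) \<le> 1"
  shows "max 0 (ln (norm a)) \<le> max 0 (ln (norm b)) + ln 2"
proof -
  have "norm a \<le> norm b + 1" using assms norm_triangle_ineq2[of a b] by linarith
  then have "ln (max 1 (norm a)) \<le> ln (max 1 (norm b) * 2)" by (intro ln_mono) (auto simp: max_def)
  also have "\<dots> = ln (max 1 (norm b)) + ln 2" by (intro ln_mult_pos) auto
  finally show ?thesis by (simp add: max_0_ln)
qed

text \<open>
  Of the positive part of the \<open>p\<close>-ball the product formula uses only these properties. Boundedness makes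
  the supporting function real-valued. The third one, a weak form of being closed downwards, ensures that
  the supporting function takes the same value at a vector and at its positive part.
\<close>

locale bounded_lower_set =
  fixes S :: "(real ^ 'n::finite) set"
  assumes bounded: "bounded S"
    and nonneg: "x \<in> S \<Longrightarrow> 0 \<le> x $ j"
    and restrict: "x \<in> S \<Longrightarrow> (\<chi> j. if P j then x $ j else 0) \<in> S"
    and zero: "0 \<in> S"
begin

abbreviation "\<phi> \<equiv> supporting_function S"

lemma bdd: "bdd_above ((\<lambda>x. x \<bullet> \<xi>) ` S)"
proof -
  obtain B where B: "\<And>x. x \<in> S \<Longrightarrow> norm x \<le> B" using bounded unfolding bounded_iff by blast
  have "x \<bullet> \<xi> \<le> B * norm \<xi>" if "x \<in> S" for x
    using norm_cauchy_schwarz[of x \<xi>] mult_right_mono[OF B[OF that], of "norm \<xi>"] by simp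
  then show ?thesis by (auto simp: bdd_above_def)
qed

lemma inner_le_support: "x \<in> S \<Longrightarrow> x \<bullet> \<xi> \<le> \<phi> \<xi>"
  unfolding supporting_function_def by (intro cSUP_upper bdd)

lemma support_least: "(\<And>x. x \<in> S \<Longrightarrow> x \<bullet> \<xi> \<le> c) \<Longrightarrow> \<phi> \<xi> \<le> c"
  unfolding supporting_function_def using zero by (intro cSUP_least) auto

lemma support_nonneg: "0 \<le> \<phi> \<xi>"
  using inner_le_support[OF zero, of \<xi>] by simp

lemma support_mono:
  assumes "\<And>j. \<xi> $ j \<le> \<eta> $ j"
  shows "\<phi> \<xi> \<le> \<phi> \<eta>"
proof (rule support_least)
  fix x assume x: "x \<in> S"
  have "x \<bullet> \<xi> \<le> x \<bullet> \<eta>"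
    unfolding inner_vec_def using assms nonneg[OF x] by (intro sum_mono) (simp add: mult_left_mono)
  then show "x \<bullet> \<xi> \<le> \<phi> \<eta>" using inner_le_support[OF x, of \<eta>] by simp
qed

lemma support_add: "\<phi> (\<xi> + \<eta>) \<le> \<phi> \<xi> + \<phi> \<eta>"
  by (rule support_least) (simp add: inner_add_right add_mono inner_le_support)

lemma support_scale: "c \<ge> 0 \<Longrightarrow> \<phi> (c *\<^sub>R \<xi>) \<le> c * \<phi> \<xi>"
  by (rule support_least) (simp add: mult_left_mono inner_le_support)

text \<open>
  The Lelong class only sees \<open>log_supporting_function\<close> up to an additive constant. It is therefore
  enough to compare it with the value at \<open>log\<^sup>+\<close> of the coordinates with a bounded error, and the
  upper limit can be estimated crudely on a unit ball, without any continuity of the supporting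
  function. The next lemma is the converse estimate.
\<close>

lemma log_supporting_function_le:
  "log_supporting_function S z \<le> ereal (\<phi> (\<chi> j. max 0 (ln (norm (z $ j)))) + \<phi> (\<chi> j. ln 2))"
proof (cases "z \<in> cstar")
  case True
  have "\<phi> (\<chi> j. ln (norm (z $ j))) \<le> \<phi> (\<chi> j. max 0 (ln (norm (z $ j))))" by (rule support_mono) simp
  then show ?thesis using True support_nonneg[of "\<chi> j. ln 2"] by (simp add: log_supporting_function_def)
next
  case False
  have "eventually (\<lambda>w. dist w z < 1) (at z within cstar)"
    by (auto simp: eventually_at intro!: exI[of _ 1])
  then have "eventually (\<lambda>w. ereal (\<phi> (\<chi> j. ln (norm (w $ j))))
      \<le> ereal (\<phi> (\<chi> j. max 0 (ln (norm (z $ j)))) + \<phi> (\<chi> j. ln 2))) (at z within cstar)"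
  proof eventually_elim
    case (elim w)
    have "ln (norm (w $ j)) \<le> max 0 (ln (norm (z $ j))) + ln 2" for j
    proof -
      have "norm ((w - z) $ j) \<le> norm (w - z)" by (rule Finite_Cartesian_Product.norm_nth_le)
      then have "norm (w $ j - z $ j) \<le> 1" using elim by (simp add: dist_norm)
      from ln_max_1_perturb[OF this] show ?thesis by simp
    qed
    then have "\<phi> (\<chi> j. ln (norm (w $ j))) \<le> \<phi> ((\<chi> j. max 0 (ln (norm (z $ j)))) + (\<chi> j. ln 2))"
      by (intro support_mono) simp
    also have "\<dots> \<le> \<phi> (\<chi> j. max 0 (ln (norm (z $ j)))) + \<phi> (\<chi> j. ln 2)" by (rule support_add)
    finally show ?case by simp
  qed
  then show ?thesis using False unfolding log_supporting_function_def Let_def by (simp add: Limsup_bounded)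
qed

text \<open>
  Negative logarithms do no harm because the coordinates of \<open>x\<close> with \<open>\<bar>w j\<bar> < 1\<close> can be replaced
  by \<open>0\<close> without leaving \<open>S\<close>.
\<close>

lemma le_log_supporting_function:
  assumes x: "x \<in> S"
  shows "ereal ((\<Sum>j\<in>UNIV. x $ j * max 0 (ln (norm (z $ j)))) - (\<Sum>j\<in>UNIV. x $ j * ln 2)) \<le> log_supporting_function S z"
proof -
  have on_cstar: "(\<Sum>j\<in>UNIV. x $ j * max 0 (ln (norm (w $ j)))) \<le> \<phi> (\<chi> j. ln (norm (w $ j)))" for w :: "complex ^ 'n"
  proof -
    have "(\<Sum>j\<in>UNIV. x $ j * max 0 (ln (norm (w $ j)))) = (\<chi> j. if ln (norm (w $ j)) \<ge> 0 then x $ j else 0) \<bullet> (\<chi> j. ln (norm (w $ j)))"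
      unfolding inner_vec_def by (intro sum.cong) (auto simp: max_def)
    also have "\<dots> \<le> \<phi> (\<chi> j. ln (norm (w $ j)))" by (intro inner_le_support restrict x)
    finally show ?thesis .
  qed
  have pos: "(\<Sum>j\<in>UNIV. x $ j * ln 2) \<ge> 0" using nonneg[OF x] by (intro sum_nonneg) simp
  show ?thesis
  proof (cases "z \<in> cstar")
    case True
    then show ?thesis using on_cstar[of z] pos by (simp add: log_supporting_function_def)
  next
    case False
    have "eventually (\<lambda>w. dist w z < 1) (at z within cstar)"
      by (auto simp: eventually_at intro!: exI[of _ 1])
    then have "eventually (\<lambda>w. ereal ((\<Sum>j\<in>UNIV. x $ j * max 0 (ln (norm (z $ j)))) - (\<Sum>j\<in>UNIV. x $ j * ln 2))
       \<le> ereal (\<phi> (\<chi> j. ln (norm (w $ j))))) (at z within cstar)"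
    proof eventually_elim
      case (elim w)
      have "max 0 (ln (norm (z $ j))) \<le> max 0 (ln (norm (w $ j))) + ln 2" for j
      proof -
        have "norm ((z - w) $ j) \<le> norm (z - w)" by (rule Finite_Cartesian_Product.norm_nth_le)
        then have "norm (z $ j - w $ j) \<le> 1" using elim by (simp add: dist_norm norm_minus_commute)
        then show ?thesis by (rule ln_max_1_perturb)
      qed
      then have "(\<Sum>j\<in>UNIV. x $ j * max 0 (ln (norm (z $ j)))) \<le> (\<Sum>j\<in>UNIV. x $ j * (max 0 (ln (norm (w $ j))) + ln 2))"
        using nonneg[OF x] by (intro sum_mono mult_left_mono)
      then show ?case using on_cstar[of w] by (simp add: distrib_left sum.distrib)
    qed
    from le_Limsup[OF cstar_not_trivial this] show ?thesis
      using False unfolding log_supporting_function_def Let_def by simp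
  qed
qed

section \<open>The product formula\<close>

text \<open>
  The competitors for the lower bound: weighted sums of one-variable competitors, with weights
  from \<open>S\<close>. Passing to positive parts makes them real-valued and keeps them in the class.
\<close>

lemma le_siciak_zakharyuta_product:
  assumes x: "x \<in> S" and u: "\<And>j. u j \<in> lelong_class1" and uK: "\<And>j \<zeta>. \<zeta> \<in> K j \<Longrightarrow> u j \<zeta> \<le> 0"
  shows "ereal (\<Sum>j\<in>UNIV. x $ j * real_of_ereal (max 0 (u j (z $ j)))) \<le> siciak_zakharyuta S {w. \<forall>j. w $ j \<in> K j} z"
proof -
  define w where "w j \<zeta> = real_of_ereal (max 0 (u j \<zeta>))" for j \<zeta>
  have sh: "subharmonic (u j)" for j using u[of j] by (simp add: lelong_class1_def)
  have w: "ereal (w j \<zeta>) = max 0 (u j \<zeta>)" for j \<zeta>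
  proof -
    have "u j \<zeta> \<noteq> \<infinity>" using sh[of j] by (auto simp: subharmonic_def)
    then show ?thesis unfolding w_def by (cases "u j \<zeta>") (auto simp: max_def zero_ereal_def)
  qed
  have w0: "w j \<zeta> \<ge> 0" for j \<zeta> unfolding w_def by (intro real_of_ereal_pos) simp
  define U where "U = (\<lambda>y :: complex ^ 'n. ereal (\<Sum>j\<in>UNIV. x $ j * w j (y $ j)))"
  have "plurisubharmonic U"
    unfolding U_def
  proof (rule plurisubharmonic_separate_sum)
    show "subharmonic (\<lambda>\<zeta>. ereal (w j \<zeta>))" for j unfolding w by (rule subharmonic_max_0[OF sh])
  qed (auto simp: w0 nonneg[OF x])
  moreover have "\<exists>c :: real. \<forall>y. U y \<le> log_supporting_function S y + ereal c"
  proof -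
    have "\<forall>j. \<exists>c :: real. \<forall>\<zeta>. u j \<zeta> \<le> ereal (max 0 (ln (norm \<zeta>)) + c)" using u by (auto simp: lelong_class1_def)
    then obtain c where c: "\<And>j \<zeta>. u j \<zeta> \<le> ereal (max 0 (ln (norm \<zeta>)) + c j)" by metis
    have wle: "w j \<zeta> \<le> max 0 (ln (norm \<zeta>)) + max 0 (c j)" for j \<zeta>
    proof -
      have "ereal (w j \<zeta>) \<le> ereal (max 0 (ln (norm \<zeta>)) + max 0 (c j))"
        unfolding w using c[of j \<zeta>] by (auto intro: order_trans)
      then show ?thesis by simp
    qed
    define C where "C = (\<Sum>j\<in>UNIV. x $ j * max 0 (c j))"
    define D where "D = (\<Sum>j\<in>UNIV. x $ j * ln 2)"
    have "U y \<le> log_supporting_function S y + ereal (D + C)" for y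
    proof -
      have "(\<Sum>j\<in>UNIV. x $ j * w j (y $ j)) \<le> (\<Sum>j\<in>UNIV. x $ j * (max 0 (ln (norm (y $ j))) + max 0 (c j)))"
        by (intro sum_mono mult_left_mono wle nonneg[OF x])
      also have "\<dots> = ((\<Sum>j\<in>UNIV. x $ j * max 0 (ln (norm (y $ j)))) - D) + (D + C)"
        by (simp add: distrib_left sum.distrib C_def)
      finally have "U y \<le> ereal ((\<Sum>j\<in>UNIV. x $ j * max 0 (ln (norm (y $ j)))) - D) + ereal (D + C)"
        by (simp add: U_def)
      also have "\<dots> \<le> log_supporting_function S y + ereal (D + C)"
        unfolding D_def by (intro add_right_mono le_log_supporting_function x)
      finally show ?thesis .
    qed
    then show ?thesis by blast
  qed
  ultimately have "U \<in> lelong_class S" by (simp add: lelong_class_def)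
  moreover have "\<forall>y\<in>{w. \<forall>j. w $ j \<in> K j}. U y \<le> 0"
  proof
    fix y :: "complex ^ 'n" assume y: "y \<in> {w. \<forall>j. w $ j \<in> K j}"
    have "w j (y $ j) = 0" for j
    proof -
      have "max 0 (u j (y $ j)) = 0" using uK[of "y $ j" j] y by (auto simp: max_def)
      then show ?thesis by (simp add: w_def)
    qed
    then show "U y \<le> 0" by (simp add: U_def)
  qed
  ultimately have "U z \<le> siciak_zakharyuta S {w. \<forall>j. w $ j \<in> K j} z"
    unfolding siciak_zakharyuta_def by (intro SUP_upper) auto
  then show ?thesis by (simp add: U_def w_def)
qed

lemma siciak_zakharyuta_product_ge:
  assumes v: "\<And>j. ereal (v j) \<le> siciak_zakharyuta1 (K j) (z $ j)"
  shows "ereal (\<phi> (\<chi> j. v j)) \<le> siciak_zakharyuta S {w. \<forall>j. w $ j \<in> K j} z" (is "_ \<le> ?V")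
proof -
  have approx: "ereal (x \<bullet> (\<chi> j. v j) - e * (\<Sum>j\<in>UNIV. x $ j)) \<le> ?V" if x: "x \<in> S" and e: "e > 0" for x e
  proof -
    have "\<exists>u. u \<in> lelong_class1 \<and> (\<forall>\<zeta>\<in>K j. u \<zeta> \<le> 0) \<and> ereal (v j - e) < u (z $ j)" for j
    proof -
      have "ereal (v j - e) < siciak_zakharyuta1 (K j) (z $ j)" using v[of j] e by (auto intro: less_le_trans[rotated])
      then show ?thesis unfolding siciak_zakharyuta1_def less_SUP_iff by auto
    qed
    then obtain u where u: "\<And>j. u j \<in> lelong_class1" "\<And>j \<zeta>. \<zeta> \<in> K j \<Longrightarrow> u j \<zeta> \<le> 0"
      "\<And>j. ereal (v j - e) < u j (z $ j)" by metis
    have "v j - e \<le> real_of_ereal (max 0 (u j (z $ j)))" for j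
    proof -
      have "u j (z $ j) \<noteq> \<infinity>" using u(1)[of j] by (auto simp: lelong_class1_def subharmonic_def)
      then show ?thesis using u(3)[of j] by (cases "u j (z $ j)") (auto simp: max_def zero_ereal_def)
    qed
    then have "(\<Sum>j\<in>UNIV. x $ j * (v j - e)) \<le> (\<Sum>j\<in>UNIV. x $ j * real_of_ereal (max 0 (u j (z $ j))))"
      using nonneg[OF x] by (intro sum_mono mult_left_mono)
    moreover have "(\<Sum>j\<in>UNIV. x $ j * (v j - e)) = x \<bullet> (\<chi> j. v j) - e * (\<Sum>j\<in>UNIV. x $ j)"
      by (simp add: inner_vec_def right_diff_distrib sum_subtractf sum_distrib_left mult.commute)
    ultimately show ?thesis
      using le_siciak_zakharyuta_product[of x u K z, OF x u(1,2)] by (smt (verit) ereal_less_eq(3) order_trans)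
  qed
  show ?thesis
  proof (cases ?V)
    case (real V)
    have "\<phi> (\<chi> j. v j) \<le> V"
    proof (rule support_least)
      fix x assume x: "x \<in> S"
      define s where "s = (\<Sum>j\<in>UNIV. x $ j)"
      have s: "s \<ge> 0" unfolding s_def using nonneg[OF x] by (intro sum_nonneg)
      show "x \<bullet> (\<chi> j. v j) \<le> V"
      proof (rule field_le_epsilon)
        fix e :: real assume e: "e > 0"
        have "x \<bullet> (\<chi> j. v j) - e / (s + 1) * s \<le> V"
          using approx[OF x, of "e / (s + 1)"] e s real by (simp add: s_def)
        moreover have "e / (s + 1) * s \<le> e" using e s by (simp add: field_simps)
        ultimately show "x \<bullet> (\<chi> j. v j) \<le> V + e" by linarith
      qed
    qed
    then show ?thesis using real by simp
  next
    case MInf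
    then show ?thesis using approx[OF zero, of 1] by simp
  qed simp
qed

text \<open>
  A competitor \<open>u\<close> is small on a neighbourhood of the product of the hulls, hence on a product of
  lemniscates \<open>\<bar>F j\<bar> \<le> 2\<close> with \<open>\<bar>F j\<bar> \<le> 1\<close> on \<open>K j\<close>. The point \<open>z\<close> lies in the polyhedron with
  \<open>\<sigma> = 1\<close> when \<open>l j\<close> is the degree of \<open>F j\<close> times \<open>v j + e\<close>, because \<open>ln \<bar>F j\<bar> / degree (F j)\<close> is itself at
  most the extremal function of \<open>K j\<close>. On the polyhedron with parameter \<open>T\<close> the growth of \<open>u\<close> gives a bound
  \<open>T\<close> times the supporting function plus a constant. Interpolating and letting \<open>T\<close> tend to
  infinity removes the constant.
\<close>

lemma siciak_zakharyuta_product_le: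
  assumes K: "\<And>j. compact (K j)" "\<And>j. K j \<noteq> {}"
    and v: "\<And>j. siciak_zakharyuta1 (K j) (z $ j) \<le> ereal (v j)" "\<And>j. v j \<ge> 0"
  shows "siciak_zakharyuta S {w. \<forall>j. w $ j \<in> K j} z \<le> ereal (\<phi> (\<chi> j. v j))"
  unfolding siciak_zakharyuta_def
proof (rule SUP_least)
  fix u assume "u \<in> {u \<in> lelong_class S. \<forall>w\<in>{w. \<forall>j. w $ j \<in> K j}. u w \<le> 0}"
  then obtain c0 where psh: "plurisubharmonic u" and growth: "\<And>w. u w \<le> log_supporting_function S w + ereal c0"
    and uK: "\<And>w. (\<And>j. w $ j \<in> K j) \<Longrightarrow> u w \<le> 0"
    by (auto simp: lelong_class_def)
  have claim: "u z \<le> ereal (e + \<phi> (\<chi> j. v j + e))" if e: "e > 0" for e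
  proof -
    define X where "X = {w :: complex ^ 'n. \<forall>j. w $ j \<in> poly_hull (K j)}"
    have X: "compact X" unfolding X_def by (intro compact_vec_product compact_poly_hull K)
    have "X \<subseteq> {w. u w < ereal e}"
      using plurisubharmonic_le_on_poly_hull[OF psh K(1) uK] e by (force simp: X_def intro: le_less_trans)
    moreover have "open {w. u w < ereal e}" using plurisubharmonic_usc[OF psh] by (simp add: usc_def)
    ultimately have "\<exists>d>0. \<forall>x\<in>X. \<forall>y\<in>- {w. u w < ereal e}. d \<le> dist x y"
      using X by (intro separate_compact_closed) auto
    then obtain d where d: "d > 0" "\<And>x y. x \<in> X \<Longrightarrow> dist x y < d \<Longrightarrow> u y < ereal e"
      by (metis (mono_tags, lifting) ComplI linorder_not_less mem_Collect_eq)
    define d' where "d' = d / (real CARD('n) + 1)"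
    have d': "d' > 0" "real CARD('n) * d' < d" using d by (auto simp: d'_def field_simps)
    define U where "U j = (\<Union>x\<in>poly_hull (K j). ball x d')" for j
    have U: "open (U j)" "poly_hull (K j) \<subseteq> U j" for j
      using d'(1) by (auto simp: U_def)
    have uU: "u w < ereal e" if w: "\<And>j. w $ j \<in> U j" for w
    proof -
      have "\<forall>j. \<exists>x\<in>poly_hull (K j). dist x (w $ j) < d'" using w by (simp add: U_def)
      then obtain x where x: "\<And>j. x j \<in> poly_hull (K j)" "\<And>j. dist (x j) (w $ j) < d'" by metis
      have "norm ((\<chi> j. x j) - w) \<le> (\<Sum>j\<in>UNIV. norm (((\<chi> j. x j) - w) $ j))"
        unfolding norm_vec_def by (rule L2_set_le_sum) simp
      also have "\<dots> \<le> (\<Sum>j\<in>(UNIV :: 'n set). d')"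
        using x(2) by (intro sum_mono) (simp add: dist_norm less_imp_le)
      also have "\<dots> < d" using d'(2) by simp
      finally have "dist (\<chi> j. x j) w < d" by (simp add: dist_norm)
      moreover have "(\<chi> j. x j) \<in> X" using x(1) by (simp add: X_def)
      ultimately show ?thesis using d(2) by blast
    qed
    have "\<forall>j. \<exists>F. degree F > 0 \<and> (\<forall>w\<in>K j. norm (poly F w) \<le> 1) \<and> (\<forall>w. norm (poly F w) \<le> 2 \<longrightarrow> w \<in> U j)"
      using hilbert_lemniscate[OF K U] by metis
    then obtain F where F: "\<And>j. degree (F j) > 0" "\<And>j w. w \<in> K j \<Longrightarrow> norm (poly (F j) w) \<le> 1"
      "\<And>j w. norm (poly (F j) w) \<le> 2 \<Longrightarrow> w \<in> U j" by metis
    have "\<forall>j. \<exists>C. (\<forall>\<zeta>. degree (F j) * max 0 (ln (norm \<zeta>)) \<le> ln (max 1 (norm (poly (F j) \<zeta>))) + C)"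
      using poly_growth[OF F(1)] by metis
    then obtain C where C: "\<And>j \<zeta>. degree (F j) * max 0 (ln (norm \<zeta>)) \<le> ln (max 1 (norm (poly (F j) \<zeta>))) + C j"
      by metis
    define m where "m = (\<chi> j. v j + e)"
    define l where "l j = degree (F j) * (v j + e)" for j
    have l: "l j > 0" for j using F(1)[of j] v(2)[of j] e by (simp add: l_def)
    have zl: "norm (poly (F j) (z $ j)) < exp (l j * 1)" for j
    proof -
      have "ereal (ln (max 1 (norm (poly (F j) (z $ j)))) / degree (F j)) \<le> ereal (v j)"
        using poly_le_siciak_zakharyuta1[OF F(1,2)] v(1) order_trans by blast
      then have "ln (max 1 (norm (poly (F j) (z $ j)))) \<le> degree (F j) * v j"
        using F(1)[of j] by (simp add: field_simps)
      also have "\<dots> < l j" using F(1)[of j] e by (simp add: l_def)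
      finally have "exp (ln (max 1 (norm (poly (F j) (z $ j))))) < exp (l j)" by (rule exp_less_mono)
      moreover have "exp (ln (max 1 (norm (poly (F j) (z $ j))))) = max 1 (norm (poly (F j) (z $ j)))"
        by (rule exp_ln) simp
      ultimately show ?thesis by simp
    qed
    define cc where "cc = (\<chi> j. (ln 2 + C j) / degree (F j))"
    define B where "B = \<phi> cc + \<phi> (\<chi> j. ln 2) + c0"
    have ub: "u w \<le> ereal (T * \<phi> m + B)" if T: "T > 0" and w: "\<And>j. norm (poly (F j) (w $ j)) \<le> 2 * exp (l j * T)" for T w
    proof -
      have "max 0 (ln (norm (w $ j))) \<le> (T *\<^sub>R m + cc) $ j" for j
      proof -
        have lT: "l j * T > 0" using l[of j] T by simp
        have "ln (max 1 (norm (poly (F j) (w $ j)))) \<le> ln (2 * exp (l j * T))"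
        proof (intro ln_mono)
          have "1 \<le> exp (l j * T)" using lT by simp
          then have "1 \<le> 2 * exp (l j * T)" by linarith
          then show "max 1 (norm (poly (F j) (w $ j))) \<le> 2 * exp (l j * T)"
            by (intro max.boundedI w)
        qed auto
        also have "\<dots> = ln 2 + l j * T" by (simp add: ln_mult)
        finally have "degree (F j) * max 0 (ln (norm (w $ j))) \<le> ln 2 + l j * T + C j"
          using C[of j "w $ j"] by linarith
        then have "max 0 (ln (norm (w $ j))) * degree (F j) \<le> ln 2 + l j * T + C j"
          by (simp only: mult.commute)
        then have "max 0 (ln (norm (w $ j))) \<le> (ln 2 + l j * T + C j) / degree (F j)"
          by (rule mult_imp_le_div_pos[rotated]) (use F(1)[of j] in simp)
        also have "\<dots> = (T *\<^sub>R m + cc) $ j"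
          using F(1)[of j] by (simp add: m_def cc_def l_def field_simps)
        finally show ?thesis .
      qed
      then have "\<phi> (\<chi> j. max 0 (ln (norm (w $ j)))) \<le> \<phi> (T *\<^sub>R m + cc)" by (intro support_mono) simp
      also have "\<dots> \<le> T * \<phi> m + \<phi> cc"
        using support_add[of "T *\<^sub>R m" cc] support_scale[of T m] T by linarith
      finally have le: "\<phi> (\<chi> j. max 0 (ln (norm (w $ j)))) + \<phi> (\<chi> j. ln 2) + c0 \<le> T * \<phi> m + B" by (simp add: B_def)
      have "u w \<le> log_supporting_function S w + ereal c0" by (rule growth)
      also have "\<dots> \<le> ereal (\<phi> (\<chi> j. max 0 (ln (norm (w $ j)))) + \<phi> (\<chi> j. ln 2)) + ereal c0"
        by (intro add_right_mono log_supporting_function_le)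
      also have "\<dots> \<le> ereal (T * \<phi> m + B)" using le by simp
      finally show ?thesis .
    qed
    have had: "u z \<le> ereal (e + \<phi> m + (B - e) / T)" if T: "T > 1" for T
    proof -
      have "u z \<le> ereal (e + (T * \<phi> m + B - e) / T * 1)"
      proof (rule hadamard_lemniscate[OF psh F(1) l, where s = 1 and T = T])
        show "u w \<le> ereal e" if "\<And>j. norm (poly (F j) (w $ j)) \<le> 2" for w
          using uU[of w] F(3) that by (simp add: less_imp_le)
        show "u w \<le> ereal (T * \<phi> m + B)" if "\<And>j. norm (poly (F j) (w $ j)) \<le> 2 * exp (l j * T)" for w
          using ub[OF _ that] T by simp
      qed (use T zl in auto)
      also have "e + (T * \<phi> m + B - e) / T * 1 = e + \<phi> m + (B - e) / T" using T by (simp add: field_simps)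
      finally show ?thesis .
    qed
    have "((\<lambda>T. ereal (e + \<phi> m + (B - e) / T)) \<longlongrightarrow> ereal (e + \<phi> m + 0)) at_top"
      by (intro tendsto_intros tendsto_divide_0[OF tendsto_const] filterlim_at_top_imp_at_infinity filterlim_ident)
    then have "u z \<le> ereal (e + \<phi> m + 0)"
      by (rule tendsto_lowerbound) (auto intro: eventually_mono[OF eventually_gt_at_top[of 1]] had)
    then show ?thesis by (simp add: m_def)
  qed
  show "u z \<le> ereal (\<phi> (\<chi> j. v j))"
  proof (rule ereal_le_epsilon2)
    fix e :: real assume e: "e > 0"
    define o1 where "o1 = \<phi> (\<chi> j. 1)"
    have o1: "o1 \<ge> 0" unfolding o1_def by (rule support_nonneg)
    define e' where "e' = e / (1 + o1)"
    have e': "e' > 0" using e o1 by (simp add: e'_def)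
    have "(\<chi> j. v j + e') = (\<chi> j. v j) + e' *\<^sub>R (\<chi> j. (1 :: real))" by (simp add: vec_eq_iff)
    then have "\<phi> (\<chi> j. v j + e') \<le> \<phi> (\<chi> j. v j) + e' * o1"
      using support_add[of "\<chi> j. v j" "e' *\<^sub>R (\<chi> j. 1)"] support_scale[of e' "\<chi> j. 1"] e' unfolding o1_def by simp
    moreover have "e' + e' * o1 = e"
    proof -
      have "e' + e' * o1 = e' * (1 + o1)" by (simp add: distrib_left)
      then show ?thesis using o1 by (simp add: e'_def)
    qed
    ultimately have "e' + \<phi> (\<chi> j. v j + e') \<le> \<phi> (\<chi> j. v j) + e" by linarith
    then show "u z \<le> ereal (\<phi> (\<chi> j. v j)) + ereal e" using claim[OF e'] by (metis ereal_less_eq(3) order_trans plus_ereal.simps(1))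
  qed
qed

end

lemma lelong_class1_const: "(\<lambda>_. ereal c) \<in> lelong_class1"
proof -
  have "subharmonic (\<lambda>_. ereal c)"
    unfolding subharmonic_def circle_mean_const by (auto simp: usc_def)
  moreover have "\<exists>d. \<forall>\<zeta> :: complex. ereal c \<le> ereal (max 0 (ln (norm \<zeta>)) + d)"
    by (rule exI[of _ c]) simp
  ultimately show ?thesis by (simp add: lelong_class1_def)
qed

lemma siciak_zakharyuta1_nonneg: "0 \<le> siciak_zakharyuta1 L z"
proof -
  have "(\<lambda>_. ereal 0) z \<le> siciak_zakharyuta1 L z"
    unfolding siciak_zakharyuta1_def using lelong_class1_const[of 0] by (intro SUP_upper) auto
  then show ?thesis by (simp add: zero_ereal_def)
qed

lemma siciak_zakharyuta1_empty: "siciak_zakharyuta1 {} z = \<infinity>"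
proof -
  have "ereal c \<le> siciak_zakharyuta1 {} z" for c
    unfolding siciak_zakharyuta1_def using SUP_upper[of "\<lambda>_. ereal c" "{u \<in> lelong_class1. \<forall>w\<in>{}. u w \<le> 0}" "\<lambda>u. u z"]
      lelong_class1_const[of c] by simp
  then show ?thesis by (metis ereal_top)
qed

section \<open>The positive part of the unit ball of a p-norm\<close>

lemma lp_norm_le_1_iff:
  assumes "p > 0"
  shows "lp_norm p x \<le> 1 \<longleftrightarrow> (\<Sum>i\<in>UNIV. \<bar>x $ i\<bar> powr p) \<le> 1"
proof -
  have s: "(\<Sum>i\<in>UNIV. \<bar>x $ i\<bar> powr p) \<ge> 0" by (intro sum_nonneg) simp
  show ?thesis
  proof
    assume "lp_norm p x \<le> 1"
    then have "lp_norm p x powr p \<le> 1 powr p" using assms by (intro powr_mono2) (auto simp: lp_norm_def)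
    then show "(\<Sum>i\<in>UNIV. \<bar>x $ i\<bar> powr p) \<le> 1" using s assms by (simp add: lp_norm_def powr_powr)
  next
    assume "(\<Sum>i\<in>UNIV. \<bar>x $ i\<bar> powr p) \<le> 1"
    then have "(\<Sum>i\<in>UNIV. \<bar>x $ i\<bar> powr p) powr (1 / p) \<le> 1 powr (1 / p)" using s assms by (intro powr_mono2) auto
    then show "lp_norm p x \<le> 1" by (simp add: lp_norm_def)
  qed
qed

lemma bounded_lower_set_lp_ball:
  assumes p: "p > 0"
  shows "bounded_lower_set {x :: real ^ 'n::finite. (\<forall>j. 0 \<le> x $ j) \<and> lp_norm p x \<le> 1}"
proof
  show "bounded {x :: real ^ 'n::finite. (\<forall>j. 0 \<le> x $ j) \<and> lp_norm p x \<le> 1}"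
    unfolding bounded_iff
  proof (intro exI ballI)
    fix x :: "real ^ 'n" assume x: "x \<in> {x. (\<forall>j. 0 \<le> x $ j) \<and> lp_norm p x \<le> 1}"
    have "\<bar>x $ j\<bar> \<le> 1" for j
    proof (rule ccontr)
      assume "\<not> \<bar>x $ j\<bar> \<le> 1"
      then have "\<bar>x $ j\<bar> powr p > 1" using p powr_less_mono2[of p 1 "\<bar>x $ j\<bar>"] by simp
      moreover have "\<bar>x $ j\<bar> powr p \<le> (\<Sum>i\<in>UNIV. \<bar>x $ i\<bar> powr p)" by (intro member_le_sum) auto
      ultimately show False using x lp_norm_le_1_iff[OF p, of x] by simp
    qed
    then have "(\<Sum>j\<in>UNIV. \<bar>x $ j\<bar>) \<le> (\<Sum>j\<in>(UNIV :: 'n set). 1)" by (intro sum_mono)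
    then show "norm x \<le> real CARD('n)" using norm_le_l1_cart[of x] by simp
  qed
  fix x :: "real ^ 'n" and P j
  assume x: "x \<in> {x. (\<forall>j. 0 \<le> x $ j) \<and> lp_norm p x \<le> 1}"
  then show "0 \<le> x $ j" by simp
  have "(\<Sum>i\<in>UNIV. \<bar>(\<chi> j. if P j then x $ j else 0) $ i\<bar> powr p) \<le> (\<Sum>i\<in>UNIV. \<bar>x $ i\<bar> powr p)"
    by (intro sum_mono) simp
  also have "\<dots> \<le> 1"
    by (rule lp_norm_le_1_iff[OF p, THEN iffD1]) (use x in blast)
  finally show "(\<chi> j. if P j then x $ j else 0) \<in> {x. (\<forall>j. 0 \<le> x $ j) \<and> lp_norm p x \<le> 1}"
    using x by (simp add: lp_norm_le_1_iff[OF p])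
qed (use p in \<open>simp add: lp_norm_def\<close>)

text \<open>
  Hoelder's inequality and its case of equality, from Young's inequality for the normalised
  vector \<open>y\<close>.
\<close>

lemma supporting_function_lp_ball:
  fixes v :: "'n::finite \<Rightarrow> real"
  assumes pq: "p > 1" "q > 1" "1 / p + 1 / q = 1" and v: "\<And>j. v j \<ge> 0"
  shows "supporting_function {x. (\<forall>j. 0 \<le> x $ j) \<and> lp_norm p x \<le> 1} (\<chi> j. v j) = (\<Sum>j\<in>UNIV. v j powr q) powr (1 / q)"
    (is "supporting_function ?S _ = ?N")
proof -
  have p0: "p > 0" using pq by simp
  interpret bounded_lower_set ?S by (rule bounded_lower_set_lp_ball[OF p0])
  have s0: "(\<Sum>j\<in>UNIV. v j powr q) \<ge> 0" by (intro sum_nonneg) simp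
  show ?thesis
  proof (cases "(\<Sum>j\<in>UNIV. v j powr q) = 0")
    case True
    then have "v j = 0" for j using pq by (auto simp: sum_nonneg_eq_0_iff)
    then have "(\<chi> j. v j) = 0" by (simp add: vec_eq_iff)
    then have "supporting_function ?S (\<chi> j. v j) \<le> 0" by (intro support_least) simp
    with support_nonneg[of "\<chi> j. v j"] True show ?thesis by simp
  next
    case False
    define N where "N = ?N"
    have N: "N > 0" using False s0 by (simp add: N_def)
    have Nq: "N powr q = (\<Sum>j\<in>UNIV. v j powr q)" using s0 pq by (simp add: N_def powr_powr)
    define y where "y j = v j / N" for j
    have y: "y j \<ge> 0" "v j = N * y j" for j using v[of j] N by (auto simp: y_def)
    have ysum: "(\<Sum>j\<in>UNIV. y j powr q) = 1"
    proof -
      have "(\<Sum>j\<in>UNIV. y j powr q) = (\<Sum>j\<in>UNIV. v j powr q) / N powr q"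
        using v N by (simp add: y_def powr_divide sum_divide_distrib)
      then show ?thesis using Nq False by simp
    qed
    have "supporting_function ?S (\<chi> j. v j) \<le> N"
    proof (rule support_least)
      fix x assume x: "x \<in> ?S"
      have xs: "(\<Sum>j\<in>UNIV. x $ j powr p) \<le> 1"
      proof -
        have "(\<Sum>j\<in>UNIV. \<bar>x $ j\<bar> powr p) \<le> 1"
          by (rule lp_norm_le_1_iff[OF p0, THEN iffD1]) (use x in blast)
        moreover have "(\<Sum>j\<in>UNIV. \<bar>x $ j\<bar> powr p) = (\<Sum>j\<in>UNIV. x $ j powr p)"
          using x by (intro sum.cong) auto
        ultimately show ?thesis by simp
      qed
      have "(\<Sum>j\<in>UNIV. x $ j * y j) \<le> (\<Sum>j\<in>UNIV. x $ j powr p / p + y j powr q / q)"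
        using x y(1) pq by (intro sum_mono Youngs_inequality) auto
      also have "\<dots> = (\<Sum>j\<in>UNIV. x $ j powr p) / p + (\<Sum>j\<in>UNIV. y j powr q) / q"
        by (simp add: sum.distrib sum_divide_distrib)
      also have "\<dots> \<le> 1 / p + 1 / q" 
        unfolding ysum using pq by (intro add_mono divide_right_mono xs) auto
      finally have "(\<Sum>j\<in>UNIV. x $ j * y j) \<le> 1" using pq by simp
      then have "N * (\<Sum>j\<in>UNIV. x $ j * y j) \<le> N * 1" using N by (intro mult_left_mono) auto
      moreover have "x \<bullet> (\<chi> j. v j) = N * (\<Sum>j\<in>UNIV. x $ j * y j)"
        by (simp add: inner_vec_def y(2) sum_distrib_left algebra_simps)
      ultimately show "x \<bullet> (\<chi> j. v j) \<le> N" by simp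
    qed
    moreover have "N \<le> supporting_function ?S (\<chi> j. v j)"
    proof -
      define x where "x = (\<chi> j. y j powr (q - 1))"
      have qp: "(q - 1) * p = q" using pq by (simp add: field_simps)
      have "x \<in> ?S"
        using ysum by (simp add: lp_norm_le_1_iff[OF p0] x_def powr_powr qp)
      then have "x \<bullet> (\<chi> j. v j) \<le> supporting_function ?S (\<chi> j. v j)" by (rule inner_le_support)
      moreover have "x \<bullet> (\<chi> j. v j) = (\<Sum>j\<in>UNIV. N * y j powr q)"
        unfolding inner_vec_def
      proof (intro sum.cong refl)
        fix j
        have "y j powr (q - 1) * y j = y j powr q"
          using y(1)[of j] by (cases "y j = 0") (auto simp: powr_mult_base powr_diff field_simps)
        then show "inner (x $ j) ((\<chi> j. v j) $ j) = N * y j powr q" by (simp add: x_def y(2) algebra_simps)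
      qed
      ultimately show ?thesis using ysum by (simp flip: sum_distrib_left)
    qed
    ultimately show ?thesis by (simp add: N_def)
  qed
qed

theorem corollary1p6:
  fixes p q :: real
    and K :: "'n::finite \<Rightarrow> complex set"
    and z :: "complex ^ 'n"
  assumes "p > 1" and "q > 1" and "1 / p + 1 / q = 1"
    and "\<And>j. compact (K j)"
    and "\<And>j. \<not> polar (K j)"
  shows "ereal_powr
           (siciak_zakharyuta {x. (\<forall>j. 0 \<le> x $ j) \<and> lp_norm p x \<le> 1} {w. \<forall>j. w $ j \<in> K j} z) q
         = (\<Sum>j\<in>UNIV. ereal_powr (siciak_zakharyuta1 (K j) (z $ j)) q)"
proof -
  define S where "S = {x :: real ^ 'n. (\<forall>j. 0 \<le> x $ j) \<and> lp_norm p x \<le> 1}"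
  have p0: "p > 0" using assms(1) by simp
  interpret bounded_lower_set S unfolding S_def by (rule bounded_lower_set_lp_ball[OF p0])
  have nonneg_powr: "0 \<le> ereal_powr x q" for x by (simp add: ereal_powr_def)
  show ?thesis
  proof (cases "\<exists>j. siciak_zakharyuta1 (K j) (z $ j) = \<infinity>")
    case True
    then obtain i where i: "siciak_zakharyuta1 (K i) (z $ i) = \<infinity>" by blast
    have "siciak_zakharyuta S {w. \<forall>j. w $ j \<in> K j} z = \<infinity>"
    proof (rule ereal_top)
      fix B :: real
      \<comment> \<open>the \<open>i\<close>-th unit vector is in \<open>S\<close>, so the \<open>i\<close>-th variable alone forces the value \<open>\<infinity>\<close>\<close>
      define v where "v j = (if j = i then B else 0)" for j
      have "axis i 1 \<in> S"
      proof -
        have "(\<Sum>j\<in>UNIV. \<bar>axis i 1 $ j\<bar> powr p) = (\<Sum>j\<in>UNIV. if j = i then 1 else 0)"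
          by (intro sum.cong) (auto simp: axis_def)
        then show ?thesis unfolding S_def by (simp add: lp_norm_le_1_iff[OF p0] axis_def)
      qed
      then have "axis i 1 \<bullet> (\<chi> j. v j) \<le> supporting_function S (\<chi> j. v j)" by (rule inner_le_support)
      then have "B \<le> supporting_function S (\<chi> j. v j)" by (simp add: inner_axis' v_def)
      moreover have "ereal (supporting_function S (\<chi> j. v j)) \<le> siciak_zakharyuta S {w. \<forall>j. w $ j \<in> K j} z"
        by (rule siciak_zakharyuta_product_ge)
          (use i siciak_zakharyuta1_nonneg in \<open>auto simp: v_def simp flip: zero_ereal_def\<close>)
      ultimately show "ereal B \<le> siciak_zakharyuta S {w. \<forall>j. w $ j \<in> K j} z"
        by (meson ereal_less_eq(3) order_trans)
    qed
    moreover have "(\<Sum>j\<in>UNIV. ereal_powr (siciak_zakharyuta1 (K j) (z $ j)) q) = \<infinity>"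
      unfolding sum_Pinfty using i by (auto simp: ereal_powr_def)
    ultimately show ?thesis by (simp add: ereal_powr_def S_def)
  next
    case False
    define v where "v j = real_of_ereal (siciak_zakharyuta1 (K j) (z $ j))" for j
    have v: "siciak_zakharyuta1 (K j) (z $ j) = ereal (v j)" "v j \<ge> 0" for j
      using False siciak_zakharyuta1_nonneg[of "K j" "z $ j"]
      by (auto simp: v_def ereal_real real_of_ereal_pos)
    have ne: "K j \<noteq> {}" for j
    proof
      assume "K j = {}"
      then show False using False siciak_zakharyuta1_empty[of "z $ j"] by metis
    qed
    have "siciak_zakharyuta S {w. \<forall>j. w $ j \<in> K j} z = ereal (supporting_function S (\<chi> j. v j))"
      using siciak_zakharyuta_product_le[of K z v] siciak_zakharyuta_product_ge[of v K z] assms(4) ne v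
      by (intro antisym) auto
    also have "supporting_function S (\<chi> j. v j) = (\<Sum>j\<in>UNIV. v j powr q) powr (1 / q)"
      unfolding S_def by (rule supporting_function_lp_ball) (use assms v in auto)
    finally have "ereal_powr (siciak_zakharyuta S {w. \<forall>j. w $ j \<in> K j} z) q
        = ereal (((\<Sum>j\<in>UNIV. v j powr q) powr (1 / q)) powr q)"
      by (simp add: ereal_powr_def)
    also have "((\<Sum>j\<in>UNIV. v j powr q) powr (1 / q)) powr q = (\<Sum>j\<in>UNIV. v j powr q)"
      using assms(2) by (simp add: powr_powr sum_nonneg)
    also have "ereal (\<Sum>j\<in>UNIV. v j powr q) = (\<Sum>j\<in>UNIV. ereal_powr (siciak_zakharyuta1 (K j) (z $ j)) q)"
      by (simp add: v(1) ereal_powr_def)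
    finally show ?thesis by (simp add: S_def)
  qed
qed

end
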